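(* Let $\mathcal{A}$ be an open set of $\mathbb{R}^3$ and $h:\mathcal{A}\to\mathbb{R}$ a smooth function. Let $I\in\mathcal{A}$ be a point such that $\nabla h(I)\neq 0$. Suppose that: 1. $h$ is five-jet non-degenerate at $I$, i.e. the only $v\in\mathbb{R}^3$ with $h^1_I[v]=0$, $h^2_I[v,v]=0$, $h^3_I[v,v,v]=0$, $h^4_I[v,v,v,v]=0$, $h^5_I[v,v,v,v,v]=0$ is $v=0$; 2. for every $v\in\mathbb{R}^3$, $v\neq 0$, such that $h^1_I[v]=h^2_I[v,v]=h^3_I[v,v,v]=0$, any vector $u\in\mathbb{R}^3$ solving the system $$h^1_I[u]=0,\qquad h^2_I[u,v]=0,\qquad h^2_I[u,u]\,h_I^4[v,v,v,v]=3\,(h_I^3[v,v,u])^2$$ satisfies $\mathrm{rk}(u,v)<2$. Then $h$ is steep in some neighborhood of $I$.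
   Context: Notation: for a smooth function $h$ of $n$ variables, $h_I^k[v^1,\dots,v^k]=\sum_{i_1,\dots,i_k=1}^n \frac{\partial^k h}{\partial I_{i_1}\cdots\partial I_{i_k}}(I)\,v^1_{i_1}\cdots v^k_{i_k}$ for $v^1,\dots,v^k\in\mathbb{R}^n$. $\mathrm{rk}(v_1,\dots,v_m)$ is the rank of the matrix with columns $v_1,\dots,v_m$. Steepness at a point: let $\mathcal{A}\subset\mathbb{R}^n$ be open and $h:\mathcal{A}\to\mathbb{R}$ smooth. $h$ is steep at $I\in\mathcal{A}$ if $\nabla h(I)\neq 0$ and if, for every $m=1,\dots,n-1$, there exist constants $C_m>0$, $\delta_m>0$, $\alpha_m>1$ such that, for all $m$-dimensional affine subspaces $\Lambda_m^I$ through $I$ orthogonal to $\nabla h(I)$, the gradient $\nabla(h|_{\Lambda_m^I})$ of the restriction of $h$ to $\Lambda_m^I$ satisfies $$\max_{0\le\eta\le\xi}\Big(\min_{I'\in\Lambda_m^I,\ \|I-I'\|=\eta}\|\nabla(h|_{\Lambda_m^I})(I')\|\Big)>C_m\xi^{\alpha_m}\qquad\forall\,\xi\in(0,\delta_m].$$ The $C_m,\delta_m$ are called steepness coefficients and the $\alpha_m$ steepness indices. $h$ is steep in a given domain if it is steep at each point of that domain with uniform indices and coefficients (the same $C_m,\delta_m,\alpha_m$ at all points). *)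

theory Defs
  imports "HOL-Analysis.Analysis"
begin

definition partial :: "'n::finite \<Rightarrow> (real^'n \<Rightarrow> real) \<Rightarrow> real^'n \<Rightarrow> real" where
  "partial i f x = deriv (\<lambda>t. f (x + t *\<^sub>R axis i 1)) 0"

primrec iter_partial :: "'n::finite list \<Rightarrow> (real^'n \<Rightarrow> real) \<Rightarrow> real^'n \<Rightarrow> real" where
  "iter_partial [] f = f"
| "iter_partial (i # is) f = partial i (iter_partial is f)"

(* Differentiability of all iterated partial derivatives forces their continuity, so for open A
   this is membership in the class C^infinity on A.  A function on A is represented by a total
   function; its values outside the open set A play no role. *)
definition smooth_on :: "(real^'n::finite) set \<Rightarrow> (real^'n \<Rightarrow> real) \<Rightarrow> bool" where
  "smooth_on A f \<longleftrightarrow> (\<forall>is. iter_partial is f differentiable_on A)"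

definition gradient :: "(real^'n::finite \<Rightarrow> real) \<Rightarrow> real^'n \<Rightarrow> real^'n" where
  "gradient f x = (\<chi> i. partial i f x)"

(* The k-linear form f^k_x[v1,...,vk], with k the length of the list of vectors. *)
definition diff_form :: "(real^'n::finite \<Rightarrow> real) \<Rightarrow> real^'n \<Rightarrow> (real^'n) list \<Rightarrow> real" where
  "diff_form f x vs =
     (\<Sum>is | length is = length vs. iter_partial is f x * (\<Prod>j<length vs. vs ! j $ (is ! j)))"

(* Gradient at x of the restriction of f to the affine subspace L, for x in L: the vector g of the
   direction space of L (that is, x + g lies in L) representing the derivative of f along L. *)
definition gradient_on :: "(real^'n::finite) set \<Rightarrow> (real^'n \<Rightarrow> real) \<Rightarrow> real^'n \<Rightarrow> real^'n" where
  "gradient_on L f x = (THE g. x + g \<in> L \<and> (f has_derivative (\<lambda>w. g \<bullet> w)) (at x within L))"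

(* The steepness inequality at x for dimension m with coefficients C, \<delta> and index \<alpha>.  The closed
   ball of radius \<delta> must lie in the domain A of f, so that all gradients involved are those of f on
   its domain.  For f smooth on A the gradient norm is then continuous on compact spheres, the
   infimum and the supremum are attained, and they are the minimum and the maximum. *)
definition steep_ineq ::
  "(real^'n::finite) set \<Rightarrow> (real^'n \<Rightarrow> real) \<Rightarrow> nat \<Rightarrow> real \<Rightarrow> real \<Rightarrow> real \<Rightarrow> real^'n \<Rightarrow> bool" where
  "steep_ineq A f m C \<delta> \<alpha> x \<longleftrightarrow>
     cball x \<delta> \<subseteq> A \<and>
     (\<forall>L. affine L \<and> aff_dim L = int m \<and> x \<in> L \<and> (\<forall>y\<in>L. (y - x) \<bullet> gradient f x = 0) \<longrightarrow>
       (\<forall>\<xi>. 0 < \<xi> \<and> \<xi> \<le> \<delta> \<longrightarrow>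
         (SUP \<eta>\<in>{0..\<xi>}. INF y\<in>{y \<in> L. norm (x - y) = \<eta>}. norm (gradient_on L f y))
           > C * \<xi> powr \<alpha>))"

definition steep_at :: "(real^'n::finite) set \<Rightarrow> (real^'n \<Rightarrow> real) \<Rightarrow> real^'n \<Rightarrow> bool" where
  "steep_at A f x \<longleftrightarrow>
     gradient f x \<noteq> 0 \<and>
     (\<forall>m\<in>{1..<CARD('n)}. \<exists>C \<delta> \<alpha>. C > 0 \<and> \<delta> > 0 \<and> \<alpha> > 1 \<and> steep_ineq A f m C \<delta> \<alpha> x)"

(* Steepness at all points of U with coefficients and indices that do not depend on the point. *)
definition steep_on :: "(real^'n::finite) set \<Rightarrow> (real^'n \<Rightarrow> real) \<Rightarrow> (real^'n) set \<Rightarrow> bool" where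
  "steep_on A f U \<longleftrightarrow>
     (\<forall>x\<in>U. gradient f x \<noteq> 0) \<and>
     (\<forall>m\<in>{1..<CARD('n)}. \<exists>C \<delta> \<alpha>. C > 0 \<and> \<delta> > 0 \<and> \<alpha> > 1 \<and> (\<forall>x\<in>U. steep_ineq A f m C \<delta> \<alpha> x))"

lemma steep_at_iff_steep_on: "steep_at A f x \<longleftrightarrow> steep_on A f {x}"
  by (simp add: steep_at_def steep_on_def)

definition five_jet_nondegenerate :: "(real^'n::finite \<Rightarrow> real) \<Rightarrow> real^'n \<Rightarrow> bool" where
  "five_jet_nondegenerate f x \<longleftrightarrow>
     (\<forall>v. (\<forall>k\<in>{1..5}. diff_form f x (replicate k v) = 0) \<longrightarrow> v = 0)"

(* Rank of the matrix with columns u and v. *)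
definition rk2 :: "real^'n::finite \<Rightarrow> real^'n \<Rightarrow> nat" where
  "rk2 u v = rank (transpose (vector [u, v] :: (real^'n)^2))"

end

theory Submission
  imports Defs
begin

text \<open>
  If the steepness inequality fails at \<open>x\<close> for some \<open>\<xi>\<close>, then every sphere of radius \<open>\<eta> \<le> \<xi>\<close> around \<open>x\<close> in
  the affine subspace carries a nearly critical point of the restriction. Four radii suffice for a contradiction.

  On a line the derivative of the restriction is, up to higher order, \<open>t\<close> times a cubic polynomial in \<open>t\<close>, whose
  coefficients are controlled by its values at four separated points; five-jet non-degeneracy and compactness
  bound one coefficient from below. This gives the index 4.

  On a plane orthogonal to the gradient, diagonalize the Hessian in an orthonormal basis \<open>v, e\<close> with eigenvalues
  \<open>\<epsilon>, \<mu>\<close>, \<open>\<bar>\<epsilon>\<bar> \<le> \<bar>\<mu>\<bar>\<close>. If \<open>\<bar>\<mu>\<bar>\<close> is small compared with \<open>\<xi>\<close>, the gradient of the cubic part dominates on the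
  sphere of radius \<open>\<xi>\<close>. Otherwise, at radii at most a small multiple of \<open>\<bar>\<mu>\<bar>\<close>, a nearly critical point
  \<open>x + s v + t e\<close> has \<open>t\<close> close to \<open>- b s\<^sup>2 / (2 \<mu>)\<close> with \<open>b = f\<^sup>3[v,v,e]\<close>, and the tangential derivative times \<open>\<mu>\<close>
  becomes \<open>\<mu> \<epsilon> s + \<mu> f\<^sup>3[v,v,v] s\<^sup>2 / 2 + (\<mu> f\<^sup>4[v,v,v,v] - 3 b\<^sup>2) s\<^sup>3 / 6\<close>. The second hypothesis says precisely
  that \<open>\<mu> \<epsilon>\<close>, \<open>f\<^sup>3[v,v,v]\<close> and the last coefficient do not vanish simultaneously. This gives the index 3.
\<close>

section \<open>Iterated partial derivatives\<close>

lemma smooth_on_differentiable: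
  assumes "smooth_on A f" "open A" "y \<in> A"
  shows "iter_partial is f differentiable (at y)"
  using assms unfolding smooth_on_def differentiable_on_def by (metis at_within_open)

lemma has_derivative_partial:
  fixes F :: "real^'n::finite \<Rightarrow> real"
  assumes "F differentiable (at y)"
  shows "(F has_derivative (\<lambda>z. \<Sum>i\<in>UNIV. z $ i * partial i F y)) (at y)"
proof -
  obtain F' where F': "(F has_derivative F') (at y)"
    using assms unfolding differentiable_def by blast
  have lin: "linear F'" using F' has_derivative_linear by blast
  have p: "partial i F y = F' (axis i 1)" for i
  proof -
    have 1: "((\<lambda>t. y + t *\<^sub>R axis i 1) has_derivative (\<lambda>t. t *\<^sub>R axis i 1)) (at (0::real))"
      by (auto intro!: derivative_eq_intros)
    have "((\<lambda>t. F (y + t *\<^sub>R axis i 1)) has_derivative (\<lambda>t. F' (t *\<^sub>R axis i 1))) (at (0::real))"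
      using has_derivative_compose[OF 1, of F F'] F' by simp
    then have "((\<lambda>t. F (y + t *\<^sub>R axis i 1)) has_derivative (\<lambda>t. t * F' (axis i 1))) (at (0::real))"
      using lin by (simp add: linear_cmul)
    then have "((\<lambda>t. F (y + t *\<^sub>R axis i 1)) has_real_derivative F' (axis i 1)) (at 0)"
      by (simp add: has_field_derivative_def mult.commute[of _ "F' (axis i 1)"])
    then show ?thesis unfolding partial_def by (rule DERIV_imp_deriv)
  qed
  have "F' z = (\<Sum>i\<in>UNIV. z $ i * partial i F y)" for z
  proof -
    have "z = (\<Sum>i\<in>UNIV. z $ i *\<^sub>R axis i 1)"
      by (simp add: basis_expansion flip: scalar_mult_eq_scaleR)
    then have "F' z = (\<Sum>i\<in>UNIV. F' (z $ i *\<^sub>R axis i 1))"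
      using linear_sum[OF lin] by metis
    then show ?thesis by (simp add: p linear_cmul[OF lin])
  qed
  then show ?thesis using F' by (metis (no_types, lifting) ext)
qed

lemma DERIV_along_line:
  fixes F :: "real^'n::finite \<Rightarrow> real"
  assumes "F differentiable (at (x + t *\<^sub>R z))"
  shows "((\<lambda>t. F (x + t *\<^sub>R z)) has_real_derivative
            (\<Sum>i\<in>UNIV. z $ i * partial i F (x + t *\<^sub>R z))) (at t)"
proof -
  have 1: "((\<lambda>t. x + t *\<^sub>R z) has_derivative (\<lambda>t. t *\<^sub>R z)) (at t)"
    by (auto intro!: derivative_eq_intros)
  from has_derivative_compose[OF 1 has_derivative_partial[OF assms]]
  show ?thesis
    by (rule has_derivative_imp_has_field_derivative) (simp add: sum_distrib_left mult.assoc mult.commute)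
qed

section \<open>Symmetry of iterated partial derivatives\<close>

lemma DERIV_partial:
  fixes F :: "real^'n::finite \<Rightarrow> real"
  assumes "F differentiable (at (x + t *\<^sub>R axis i 1))"
  shows "((\<lambda>t. F (x + t *\<^sub>R axis i 1)) has_real_derivative partial i F (x + t *\<^sub>R axis i 1)) (at t)"
proof -
  have "(\<Sum>j\<in>UNIV. axis i 1 $ j * partial j F y) = partial i F y" for y
    by (simp add: axis_def if_distrib[of "\<lambda>a. a * _"] cong: if_cong)
  then show ?thesis using DERIV_along_line[OF assms] by simp
qed

text \<open>The mean value theorem is applied twice: in direction \<open>j\<close> to the difference
  of \<open>F\<close> along two parallel segments, then in direction \<open>i\<close> to
  \<open>partial j F\<close>. The difference is symmetric in \<open>i\<close> and \<open>j\<close>,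
  which is what Schwarz's theorem exploits.\<close>

lemma second_difference:
  fixes F :: "real^'n::finite \<Rightarrow> real"
  assumes F: "\<And>y. y \<in> ball x r \<Longrightarrow> F differentiable (at y)"
    and Fj: "\<And>y. y \<in> ball x r \<Longrightarrow> partial j F differentiable (at y)"
    and s: "0 < s" "2 * s < r"
  shows "\<exists>p. norm (p - x) \<le> 2 * s \<and>
    F (x + s *\<^sub>R axis i 1 + s *\<^sub>R axis j 1) - F (x + s *\<^sub>R axis i 1) - F (x + s *\<^sub>R axis j 1) + F x
      = s\<^sup>2 * partial i (partial j F) p"
proof -
  let ?e = "\<lambda>k. axis k (1::real) :: real^'n"
  have nrm: "norm (u *\<^sub>R ?e i + v *\<^sub>R ?e j) \<le> 2 * s" if "0 \<le> u" "u \<le> s" "0 \<le> v" "v \<le> s" for u v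
    using norm_triangle_ineq[of "u *\<^sub>R ?e i" "v *\<^sub>R ?e j"] that by simp
  have inb: "x + u *\<^sub>R ?e i + v *\<^sub>R ?e j \<in> ball x r" if "0 \<le> u" "u \<le> s" "0 \<le> v" "v \<le> s" for u v
  proof -
    have "dist x (x + u *\<^sub>R ?e i + v *\<^sub>R ?e j) = norm (u *\<^sub>R ?e i + v *\<^sub>R ?e j)"
      by (metis add.assoc add_diff_cancel_left' dist_commute dist_norm)
    then show ?thesis using nrm[OF that] s by simp
  qed
  let ?\<phi> = "\<lambda>t. F (x + s *\<^sub>R ?e i + t *\<^sub>R ?e j) - F (x + t *\<^sub>R ?e j)"
  have d1: "(?\<phi> has_real_derivative
      (partial j F (x + s *\<^sub>R ?e i + t *\<^sub>R ?e j) - partial j F (x + t *\<^sub>R ?e j))) (at t)"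
    if "0 \<le> t" "t \<le> s" for t
    using inb[of s t] inb[of 0 t] that s by (intro DERIV_diff DERIV_partial F) auto
  obtain t where t: "0 < t" "t < s" "?\<phi> s - ?\<phi> 0 =
      (s - 0) * (partial j F (x + s *\<^sub>R ?e i + t *\<^sub>R ?e j) - partial j F (x + t *\<^sub>R ?e j))"
    using MVT2[OF s(1) d1] by blast
  have d2: "((\<lambda>u. partial j F (x + t *\<^sub>R ?e j + u *\<^sub>R ?e i)) has_real_derivative
       partial i (partial j F) (x + t *\<^sub>R ?e j + u *\<^sub>R ?e i)) (at u)"
    if "0 \<le> u" "u \<le> s" for u
    using inb[of u t] that t by (intro DERIV_partial Fj) (simp add: add.commute add.left_commute)
  obtain u where u: "0 < u" "u < s"
      "partial j F (x + t *\<^sub>R ?e j + s *\<^sub>R ?e i) - partial j F (x + t *\<^sub>R ?e j + 0 *\<^sub>R ?e i)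
       = (s - 0) * partial i (partial j F) (x + t *\<^sub>R ?e j + u *\<^sub>R ?e i)"
    using MVT2[OF s(1) d2] by blast
  show ?thesis
  proof (intro exI conjI)
    show "norm ((x + t *\<^sub>R ?e j + u *\<^sub>R ?e i) - x) \<le> 2 * s"
      using nrm[of u t] t u by (simp add: add.commute)
    have "F (x + s *\<^sub>R ?e i + s *\<^sub>R ?e j) - F (x + s *\<^sub>R ?e i) - F (x + s *\<^sub>R ?e j) + F x = ?\<phi> s - ?\<phi> 0"
      by simp
    also have "\<dots> = s * (s * partial i (partial j F) (x + t *\<^sub>R ?e j + u *\<^sub>R ?e i))"
      using t(3) u(3) by (simp add: algebra_simps)
    finally show "F (x + s *\<^sub>R ?e i + s *\<^sub>R ?e j) - F (x + s *\<^sub>R ?e i) - F (x + s *\<^sub>R ?e j) + F x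
      = s\<^sup>2 * partial i (partial j F) (x + t *\<^sub>R ?e j + u *\<^sub>R ?e i)"
      by (simp add: power2_eq_square)
  qed
qed

text \<open>Schwarz's theorem. The same second difference equals \<open>s\<^sup>2\<close> times one
  mixed derivative at \<open>p\<close> and \<open>s\<^sup>2\<close> times the other at
  \<open>q\<close>. Both points lie within \<open>2 * s\<close> of \<open>x\<close>, so continuity
  at \<open>x\<close> rules out different values there.\<close>

lemma partial_commute:
  fixes F :: "real^'n::finite \<Rightarrow> real"
  assumes "open A" "x \<in> A"
    and F: "\<And>y. y \<in> A \<Longrightarrow> F differentiable (at y)"
    and F1: "\<And>y k. y \<in> A \<Longrightarrow> partial k F differentiable (at y)"
    and cont: "isCont (partial i (partial j F)) x" "isCont (partial j (partial i F)) x"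
  shows "partial i (partial j F) x = partial j (partial i F) x"
proof (rule ccontr)
  let ?G = "partial i (partial j F)" and ?H = "partial j (partial i F)"
  assume ne: "?G x \<noteq> ?H x"
  define \<epsilon> where "\<epsilon> = \<bar>?G x - ?H x\<bar> / 2"
  have \<epsilon>: "\<epsilon> > 0" using ne by (simp add: \<epsilon>_def)
  obtain r where r: "r > 0" "ball x r \<subseteq> A" using assms openE by blast
  obtain d1 where d1: "d1 > 0" "\<And>y. dist y x < d1 \<Longrightarrow> dist (?G y) (?G x) < \<epsilon>"
    using cont(1) \<epsilon> unfolding continuous_at_eps_delta by (metis)
  obtain d2 where d2: "d2 > 0" "\<And>y. dist y x < d2 \<Longrightarrow> dist (?H y) (?H x) < \<epsilon>"
    using cont(2) \<epsilon> unfolding continuous_at_eps_delta by (metis)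
  define s where "s = min r (min d1 d2) / 3"
  have s: "0 < s" "2 * s < r" "2 * s < d1" "2 * s < d2"
    using r d1(1) d2(1) by (auto simp: s_def min_def)
  obtain p where p: "norm (p - x) \<le> 2 * s" 
      "F (x + s *\<^sub>R axis i 1 + s *\<^sub>R axis j 1) - F (x + s *\<^sub>R axis i 1) - F (x + s *\<^sub>R axis j 1) + F x = s\<^sup>2 * ?G p"
    using second_difference[of x r F j s i] F F1 r s by blast
  obtain q where q: "norm (q - x) \<le> 2 * s" 
      "F (x + s *\<^sub>R axis j 1 + s *\<^sub>R axis i 1) - F (x + s *\<^sub>R axis j 1) - F (x + s *\<^sub>R axis i 1) + F x = s\<^sup>2 * ?H q"
    using second_difference[of x r F i s j] F F1 r s by blast
  have "F (x + s *\<^sub>R axis j 1 + s *\<^sub>R axis i 1) = F (x + s *\<^sub>R axis i 1 + s *\<^sub>R axis j 1)"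
    by (simp add: add.commute add.left_commute)
  then have "s\<^sup>2 * ?G p = s\<^sup>2 * ?H q" using p(2) q(2) by linarith
  then have "?G p = ?H q" using s(1) by (metis mult_left_cancel power_not_zero less_irrefl)
  moreover have "dist (?G p) (?G x) < \<epsilon>" "dist (?H q) (?H x) < \<epsilon>"
    using d1(2)[of p] d2(2)[of q] p(1) q(1) s by (simp_all add: dist_norm)
  ultimately have "\<bar>?G x - ?H x\<bar> < 2 * \<epsilon>" by (simp add: dist_real_def)
  then show False by (simp add: \<epsilon>_def)
qed

lemma partial_cong_open:
  fixes F G :: "real^'n::finite \<Rightarrow> real"
  assumes "open A" "\<And>y. y \<in> A \<Longrightarrow> F y = G y" "x \<in> A"
  shows "partial i F x = partial i G x"
proof -
  have "continuous_on UNIV (\<lambda>t::real. x + t *\<^sub>R axis i 1)" by (intro continuous_intros)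
  then have "open ((\<lambda>t::real. x + t *\<^sub>R axis i 1) -` A)"
    using assms(1) by (simp add: open_vimage)
  then have "eventually (\<lambda>t. t \<in> (\<lambda>t::real. x + t *\<^sub>R axis i 1) -` A) (nhds 0)"
    using assms(3) by (intro eventually_nhds_in_open) auto
  then have "eventually (\<lambda>t. F (x + t *\<^sub>R axis i 1) = G (x + t *\<^sub>R axis i 1)) (nhds 0)"
    by eventually_elim (use assms(2) in auto)
  then show ?thesis unfolding partial_def by (intro deriv_cong_ev) auto
qed

text \<open>Schwarz's theorem is the base case. The outer derivatives in the prefix see only the
  values on the open set, so the equality has to be carried through the induction for all points of
  \<open>A\<close> at once.\<close>

lemma iter_partial_swap:
  assumes "smooth_on A f" "open A" "x \<in> A"
  shows "iter_partial (is @ i # j # js) f x = iter_partial (is @ j # i # js) f x"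
  using assms(3)
proof (induction "is" arbitrary: x)
  case Nil
  have d: "iter_partial ks f differentiable (at y)" if "y \<in> A" for y ks
    using smooth_on_differentiable assms that by blast
  have F: "iter_partial js f differentiable (at y)" "partial k (iter_partial js f) differentiable (at y)"
    if "y \<in> A" for y k
    using d[OF that, of js] d[OF that, of "k # js"] by simp_all
  have c: "isCont (partial k (partial l (iter_partial js f))) x" for k l
    using differentiable_imp_continuous_within[OF d[OF Nil, of "k # l # js"]] by simp
  show ?case
    using partial_commute[OF assms(2) Nil F c c] by simp
next
  case (Cons k "is")
  have "partial k (iter_partial (is @ i # j # js) f) x = partial k (iter_partial (is @ j # i # js) f) x"
    by (rule partial_cong_open[OF assms(2) Cons.IH Cons.prems])
  then show ?case by simp
qed

section \<open>The multilinear forms\<close>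

text \<open>Contraction of a coefficient array with a list of vectors, one slot at a time. This form
  of the sum in \<open>diff_form\<close> allows induction on the list of vectors.\<close>

primrec multi_eval :: "('n::finite list \<Rightarrow> real) \<Rightarrow> (real^'n) list \<Rightarrow> real" where
  "multi_eval c [] = c []"
| "multi_eval c (v # vs) = (\<Sum>i\<in>UNIV. v $ i * multi_eval (\<lambda>is. c (i # is)) vs)"

lemma multi_eval_eq:
  "multi_eval c vs = (\<Sum>is | length is = length vs. c is * (\<Prod>j<length vs. vs ! j $ (is ! j)))"
proof (induction vs arbitrary: c)
  case Nil
  then show ?case by simp
next
  case (Cons v vs)
  let ?L = "\<lambda>n. {is :: 'a list. length is = n}"
  have "(\<Sum>is\<in>?L (length (v # vs)). c is * (\<Prod>j<length (v # vs). (v # vs) ! j $ (is ! j)))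
      = (\<Sum>(i, is)\<in>UNIV \<times> ?L (length vs). c (i # is) * (\<Prod>j<length (v # vs). (v # vs) ! j $ ((i # is) ! j)))"
    by (rule sum.reindex_bij_witness[of _ "\<lambda>(i, is). i # is" "\<lambda>is. (hd is, tl is)"])
      (auto simp: length_Suc_conv)
  also have "\<dots> = (\<Sum>i\<in>UNIV. \<Sum>is\<in>?L (length vs). 
       v $ i * (c (i # is) * (\<Prod>j<length vs. vs ! j $ (is ! j))))"
    by (subst sum.cartesian_product [symmetric])
      (simp add: prod.lessThan_Suc_shift mult.left_commute del: prod.lessThan_Suc)
  finally show ?case by (simp add: Cons.IH sum_distrib_left)
qed

lemma diff_form_eq: "diff_form f x vs = multi_eval (\<lambda>is. iter_partial is f x) vs"
  by (simp add: diff_form_def multi_eval_eq)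

lemma multi_eval_coeff_add: "multi_eval (\<lambda>is. c is + d is) vs = multi_eval c vs + multi_eval d vs"
  by (induction vs arbitrary: c d) (simp_all add: distrib_left sum.distrib)

lemma multi_eval_coeff_scale: "multi_eval (\<lambda>is. r * c is) vs = r * multi_eval c vs"
  by (induction vs arbitrary: c) (simp_all add: sum_distrib_left mult.left_commute)

lemma multi_eval_coeff_sum:
  "finite S \<Longrightarrow> multi_eval (\<lambda>is. \<Sum>i\<in>S. c i is) vs = (\<Sum>i\<in>S. multi_eval (c i) vs)"
proof (induction S rule: finite_induct)
  case empty
  then show ?case using multi_eval_coeff_scale[of 0 "\<lambda>_. 0" vs] by simp
next
  case (insert i S)
  then show ?case by (simp add: multi_eval_coeff_add)
qed

lemma multi_eval_slot_linear:
  "multi_eval c (us @ (\<alpha> *\<^sub>R v + \<beta> *\<^sub>R w) # vs)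
     = \<alpha> * multi_eval c (us @ v # vs) + \<beta> * multi_eval c (us @ w # vs)"
  by (induction us arbitrary: c)
    (simp_all add: distrib_left distrib_right sum.distrib sum_distrib_left mult.assoc mult.left_commute)

lemma diff_form_slot_linear:
  "diff_form f x (us @ (\<alpha> *\<^sub>R v + \<beta> *\<^sub>R w) # vs)
     = \<alpha> * diff_form f x (us @ v # vs) + \<beta> * diff_form f x (us @ w # vs)"
  by (simp add: diff_form_eq multi_eval_slot_linear)

lemma multi_eval_swap:
  assumes "\<And>is js i j. c (is @ i # j # js) = c (is @ j # i # js)"
  shows "multi_eval c (us @ v # w # vs) = multi_eval c (us @ w # v # vs)"
  using assms
proof (induction us arbitrary: c)
  case Nil
  have c: "c (i # j # js) = c (j # i # js)" for i j js using Nil[of "[]"] by simp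
  show ?case
    by (simp add: sum_distrib_left, subst sum.swap) (simp add: c mult.left_commute)
next
  case (Cons u us)
  have "multi_eval (\<lambda>is. c (k # is)) (us @ v # w # vs) = multi_eval (\<lambda>is. c (k # is)) (us @ w # v # vs)" for k
    using Cons.prems[of "k # _"] by (intro Cons.IH) simp
  then show ?case by simp
qed

lemma diff_form_swap:
  assumes "smooth_on A f" "open A" "x \<in> A"
  shows "diff_form f x (us @ v # w # vs) = diff_form f x (us @ w # v # vs)"
  unfolding diff_form_eq using iter_partial_swap[OF assms] by (intro multi_eval_swap)

text \<open>Differentiation along \<open>z\<close> contracts one new index with \<open>z\<close>,
  and \<open>iter_partial\<close> puts that index at the head of the list. Hence differentiating a
  form along a line just prepends the direction to its arguments.\<close>

lemma diff_form_DERIV: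
  assumes "smooth_on A f" "open A" "x + t *\<^sub>R z \<in> A"
  shows "((\<lambda>t. diff_form f (x + t *\<^sub>R z) vs) has_real_derivative
           diff_form f (x + t *\<^sub>R z) (z # vs)) (at t)"
proof -
  have "((\<lambda>t. multi_eval (\<lambda>is. c is t) vs) has_real_derivative multi_eval c' vs) (at t)"
    if "\<And>is. (c is has_real_derivative c' is) (at t)" for c c'
    using that
    by (induction vs arbitrary: c c') (auto intro!: DERIV_sum DERIV_cmult)
  from this[OF DERIV_along_line[OF smooth_on_differentiable[OF assms]]] show ?thesis
    by (simp add: diff_form_eq multi_eval_coeff_sum multi_eval_coeff_scale)
qed

section \<open>Bounds, continuity and Taylor expansion of the forms\<close>

lemma multi_eval_bound:
  assumes "\<And>is. length is = length vs \<Longrightarrow> \<bar>c is\<bar> \<le> B"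
  shows "\<bar>multi_eval c vs\<bar> \<le> real CARD('n) ^ length vs * B * prod_list (map norm (vs :: (real^'n::finite) list))"
  using assms
proof (induction vs arbitrary: c)
  case Nil
  then show ?case by simp
next
  case (Cons v vs)
  have "\<bar>multi_eval c (v # vs)\<bar> \<le> (\<Sum>i\<in>UNIV. \<bar>v $ i\<bar> * \<bar>multi_eval (\<lambda>is. c (i # is)) vs\<bar>)"
    by (simp add: sum_abs flip: abs_mult)
  also have "\<dots> \<le> (\<Sum>i\<in>(UNIV::'n set). norm v * (real CARD('n) ^ length vs * B * prod_list (map norm vs)))"
    by (intro sum_mono mult_mono Cons.IH Cons.prems component_le_norm_cart) auto
  finally show ?case by (simp add: algebra_simps)
qed

lemma iter_partial_continuous_on:
  assumes "smooth_on A f" 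
  shows "continuous_on A (iter_partial is f)"
  using assms differentiable_imp_continuous_on unfolding smooth_on_def by blast

text \<open>Only finitely many index lists have length at most \<open>N\<close>, and each iterated
  partial derivative is bounded on a compact set. One constant serves all orders;
  \<open>M \<ge> 1\<close> lets later estimates absorb lower powers of \<open>M\<close> into higher
  ones.\<close>

lemma diff_form_bound:
  fixes f :: "real^'n::finite \<Rightarrow> real"
  assumes "smooth_on A f" "compact S" "S \<subseteq> A"
  shows "\<exists>M\<ge>1. \<forall>y\<in>S. \<forall>vs. length vs \<le> N \<longrightarrow> \<bar>diff_form f y vs\<bar> \<le> M * prod_list (map norm vs)"
proof -
  let ?L = "{is :: 'n list. length is \<le> N}"
  have fin: "finite ?L"
    using finite_lists_length_le[of "UNIV :: 'n set" N] by simp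
  have "\<exists>B. \<forall>y\<in>S. \<bar>iter_partial is f y\<bar> \<le> B" for "is"
  proof -
    have "compact (iter_partial is f ` S)"
      using iter_partial_continuous_on[OF assms(1)] assms(2,3)
      by (meson compact_continuous_image continuous_on_subset)
    from compact_imp_bounded[OF this] show ?thesis by (auto simp: bounded_iff)
  qed
  then obtain B where B: "\<And>is y. y \<in> S \<Longrightarrow> \<bar>iter_partial is f y\<bar> \<le> B is" by metis
  define B' where "B' = (\<Sum>is\<in>?L. \<bar>B is\<bar>)"
  have B': "\<bar>iter_partial is f y\<bar> \<le> B'" if "y \<in> S" "is \<in> ?L" for "is" y
    unfolding B'_def using B[OF that(1), of "is"] member_le_sum[OF that(2), of "\<lambda>is. \<bar>B is\<bar>"] fin by force
  have B'0: "0 \<le> B'" unfolding B'_def by (simp add: sum_nonneg)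
  define M where "M = 1 + real CARD('n) ^ N * B'"
  have "\<bar>diff_form f y vs\<bar> \<le> M * prod_list (map norm vs)" if "y \<in> S" "length vs \<le> N" for y vs
  proof -
    have p: "0 \<le> prod_list (map norm vs)" by (induction vs) auto
    have "\<bar>diff_form f y vs\<bar> \<le> real CARD('n) ^ length vs * B' * prod_list (map norm vs)"
      unfolding diff_form_eq by (intro multi_eval_bound B') (use that in auto)
    also have "\<dots> \<le> M * prod_list (map norm vs)"
      unfolding M_def using power_increasing[OF that(2), of "real CARD('n)"] B'0 p
      by (intro mult_right_mono) (auto intro!: mult_right_mono add_increasing simp: Suc_leI)
    finally show ?thesis .
  qed
  moreover have "M \<ge> 1" unfolding M_def using B'0 by simp
  ultimately show ?thesis by blast
qed

text \<open>Base point and slots depend on the same parameter, which gives joint continuity in point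
  and directions for any pattern of slots. The compactness arguments over directions rest on
  it.\<close>

lemma diff_form_continuous_on:
  assumes "smooth_on A f" "continuous_on T X" "X ` T \<subseteq> A" "\<And>W. W \<in> set Ws \<Longrightarrow> continuous_on T W"
  shows "continuous_on T (\<lambda>p. diff_form f (X p) (map (\<lambda>W. W p) Ws))"
proof -
  have "continuous_on T (\<lambda>p. multi_eval (\<lambda>is. c is p) (map (\<lambda>W. W p) Ws))"
    if "\<And>is. continuous_on T (c is)" for c
    using that assms(4)
  proof (induction Ws arbitrary: c)
    case Nil
    then show ?case by simp
  next
    case (Cons W Ws)
    have "continuous_on T (\<lambda>p. multi_eval (\<lambda>is. c (i # is) p) (map (\<lambda>W. W p) Ws))" for i
      by (rule Cons.IH) (use Cons.prems in auto)
    moreover have "continuous_on T W" using Cons.prems by simp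
    ultimately show ?case by (auto intro!: continuous_intros)
  qed
  moreover have "continuous_on T (\<lambda>p. iter_partial is f (X p))" for "is"
    using continuous_on_compose2[OF iter_partial_continuous_on[OF assms(1)] assms(2,3)] .
  ultimately show ?thesis unfolding diff_form_eq by fastforce
qed

text \<open>Maclaurin's formula along the segment from \<open>x\<close> to \<open>x + z\<close>: by
  \<open>diff_form_DERIV\<close> the \<open>k\<close>-th derivative is the form with
  \<open>k\<close> copies of \<open>z\<close> prepended.\<close>

lemma diff_form_taylor:
  assumes "smooth_on A f" "open A" "\<And>t. 0 \<le> t \<Longrightarrow> t \<le> 1 \<Longrightarrow> x + t *\<^sub>R z \<in> A" "0 < N"
  shows "\<exists>t. 0 < t \<and> t < 1 \<and> diff_form f (x + z) ws =
    (\<Sum>k<N. diff_form f x (replicate k z @ ws) / fact k)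
      + diff_form f (x + t *\<^sub>R z) (replicate N z @ ws) / fact N"
proof -
  have "\<forall>m t. m < N \<and> 0 \<le> t \<and> t \<le> 1 \<longrightarrow>
     DERIV (\<lambda>t. diff_form f (x + t *\<^sub>R z) (replicate m z @ ws)) t
        :> diff_form f (x + t *\<^sub>R z) (replicate (Suc m) z @ ws)"
    using diff_form_DERIV[OF assms(1,2)] assms(3) by auto
  from Maclaurin[OF _ assms(4) refl this] show ?thesis by simp
qed

lemma diff_form_taylor_bound:
  assumes "smooth_on A f" "open A" "convex S" "S \<subseteq> A" "x \<in> S" "x + z \<in> S" "0 < N" "0 \<le> M"
    and "\<And>y. y \<in> S \<Longrightarrow> \<bar>diff_form f y (replicate N z @ ws)\<bar> \<le> M"
  shows "\<bar>diff_form f (x + z) ws - (\<Sum>k<N. diff_form f x (replicate k z @ ws) / fact k)\<bar> \<le> M"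
proof -
  have inS: "x + t *\<^sub>R z \<in> S" if "0 \<le> t" "t \<le> 1" for t
    using convexD_alt[OF assms(3,5,6), of t] that by (simp add: algebra_simps)
  obtain t where t: "0 < t" "t < 1" "diff_form f (x + z) ws =
    (\<Sum>k<N. diff_form f x (replicate k z @ ws) / fact k)
      + diff_form f (x + t *\<^sub>R z) (replicate N z @ ws) / fact N"
    using diff_form_taylor[OF assms(1,2) _ assms(7), of x z ws] inS assms(4) by blast
  have "\<bar>diff_form f (x + t *\<^sub>R z) (replicate N z @ ws)\<bar> \<le> M"
    using assms(9) inS t by simp
  then have "\<bar>diff_form f (x + t *\<^sub>R z) (replicate N z @ ws) / fact N\<bar> \<le> M"
    using fact_ge_1[of N, where 'a=real] assms(8)
    using mult_left_mono[of 1 "fact N :: real" M] by (simp add: divide_le_eq)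
  then show ?thesis using t(3) by simp
qed

section \<open>Gradients of restrictions to affine subspaces\<close>

lemma gradient_inner_eq_diff_form: "gradient f y \<bullet> w = diff_form f y [w]"
  by (simp add: diff_form_eq gradient_def inner_vec_def mult.commute)

lemma has_derivative_gradient:
  assumes "F differentiable (at y)"
  shows "(F has_derivative (\<lambda>w. gradient F y \<bullet> w)) (at y)"
  using has_derivative_partial[OF assms] by (simp add: gradient_def inner_vec_def mult.commute)

lemma affine_direction_scale:
  fixes L :: "'a::real_vector set"
  assumes "affine L" "x \<in> L" "x + v \<in> L"
  shows "x + t *\<^sub>R v \<in> L"
  using mem_affine[OF assms(1,2,3), of "1 - t" t] by (simp add: algebra_simps)

text \<open>Both candidates are tested along \<open>g - g'\<close>, a direction of \<open>L\<close>.
  The derivatives agree there, so \<open>g - g'\<close> is orthogonal to itself. This justifies the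
  definite description in \<open>gradient_on\<close>.\<close>

lemma gradient_on_unique:
  fixes L :: "(real^'n::finite) set"
  assumes L: "affine L" "y \<in> L"
    and g: "y + g \<in> L" "(F has_derivative (\<lambda>w. g \<bullet> w)) (at y within L)"
    and g': "y + g' \<in> L" "(F has_derivative (\<lambda>w. g' \<bullet> w)) (at y within L)"
  shows "g = g'"
proof -
  let ?w = "g - g'"
  have "y + ?w \<in> L"
    using mem_affine_3_minus[OF L(1) L(2) g(1) g'(1), of 1] by simp
  then have inL: "(\<lambda>t. y + t *\<^sub>R ?w) ` UNIV \<subseteq> L"
    using affine_direction_scale[OF L] by blast
  have d: "((\<lambda>t. F (y + t *\<^sub>R ?w)) has_derivative (\<lambda>t. a \<bullet> (t *\<^sub>R ?w))) (at (0::real))"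
    if "(F has_derivative (\<lambda>w. a \<bullet> w)) (at y within L)" for a
  proof (rule has_derivative_in_compose[where f = "\<lambda>t. y + t *\<^sub>R ?w" and g = F])
    show "((\<lambda>t. y + t *\<^sub>R ?w) has_derivative (\<lambda>t. t *\<^sub>R ?w)) (at 0)"
      by (auto intro!: derivative_eq_intros)
    show "(F has_derivative (\<bullet>) a) (at (y + 0 *\<^sub>R ?w) within range (\<lambda>t. y + t *\<^sub>R ?w))"
      using has_derivative_subset[OF that inL] by simp
  qed
  have "(\<lambda>t. g \<bullet> (t *\<^sub>R ?w)) = (\<lambda>t. g' \<bullet> (t *\<^sub>R ?w))"
    using has_derivative_unique[OF d[OF g(2)] d[OF g'(2)]] .
  then have "g \<bullet> ?w = g' \<bullet> ?w" by (metis scaleR_one)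
  then have "?w \<bullet> ?w = 0" by (simp add: inner_diff_left)
  then show ?thesis by simp
qed

text \<open>The gradient of the restriction is the orthogonal projection of the full gradient onto
  the direction space of \<open>L\<close>: the orthogonal remainder does not affect increments
  inside \<open>L\<close>.\<close>

lemma gradient_on_projection:
  fixes L :: "(real^'n::finite) set"
  assumes L: "affine L" "y \<in> L" and F: "F differentiable (at y)"
  shows "y + gradient_on L F y \<in> L"
    and "y + w \<in> L \<Longrightarrow> gradient_on L F y \<bullet> w = gradient F y \<bullet> w"
proof -
  define S where "S = (\<lambda>z. z - y) ` L"
  have sp: "span S = S" unfolding S_def span_eq_iff by (rule affine_diffs_subspace_subtract[OF L])
  have S: "w \<in> S \<longleftrightarrow> y + w \<in> L" for w
    unfolding S_def image_iff by (metis add.commute add_diff_cancel_left' diff_add_cancel)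
  obtain g z where g: "g \<in> span S" and z: "\<And>w. w \<in> span S \<Longrightarrow> orthogonal z w"
    and gz: "gradient F y = g + z"
    using orthogonal_subspace_decomp_exists[of S "gradient F y"] by metis
  have eq: "g \<bullet> w = gradient F y \<bullet> w" if "y + w \<in> L" for w
  proof -
    have "z \<bullet> w = 0" using z[of w] that unfolding sp S orthogonal_def by blast
    then show ?thesis by (simp add: gz inner_add_left)
  qed
  have gL: "y + g \<in> L" using g unfolding sp S .
  have t: "((\<lambda>z. norm (F z - F y - gradient F y \<bullet> (z - y)) / norm (z - y)) \<longlongrightarrow> 0) (at y within L)"
    using has_derivative_at_withinI[OF has_derivative_gradient[OF F], of L]
    unfolding has_derivative_iff_norm by (rule conjunct2)
  have "((\<lambda>z. norm (F z - F y - g \<bullet> (z - y)) / norm (z - y)) \<longlongrightarrow> 0) (at y within L)"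
  proof (rule Lim_transform_within[OF t zero_less_one])
    fix z assume "z \<in> L"
    then show "norm (F z - F y - gradient F y \<bullet> (z - y)) / norm (z - y)
      = norm (F z - F y - g \<bullet> (z - y)) / norm (z - y)"
      using eq[of "z - y"] by simp
  qed
  then have gd: "(F has_derivative (\<lambda>w. g \<bullet> w)) (at y within L)"
    unfolding has_derivative_iff_norm by (simp add: bounded_linear_inner_right)
  have "gradient_on L F y = g"
    unfolding gradient_on_def
    by (rule the_equality) (use gL gd gradient_on_unique[OF L] in blast)+
  then show "y + gradient_on L F y \<in> L" "y + w \<in> L \<Longrightarrow> gradient_on L F y \<bullet> w = gradient F y \<bullet> w"
    using gL eq by simp_all
qed

lemma norm_gradient_on_le:
  assumes "affine L" "y \<in> L" "F differentiable (at y)"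
  shows "norm (gradient_on L F y) \<le> norm (gradient F y)"
proof -
  let ?g = "gradient_on L F y"
  have "?g \<bullet> ?g = gradient F y \<bullet> ?g"
    using gradient_on_projection[OF assms] by blast
  then have "norm ?g * norm ?g \<le> norm (gradient F y) * norm ?g"
    by (metis norm_cauchy_schwarz power2_eq_square power2_norm_eq_inner)
  then show ?thesis
    by (metis mult_right_le_imp_le norm_ge_zero order_le_less)
qed

text \<open>Cauchy-Schwarz for the projected gradient. A lower bound for the gradient of the
  restriction is thereby reduced to one directional derivative along a unit vector of the direction
  space.\<close>

lemma diff_form_le_norm_gradient_on:
  fixes L :: "(real^'n::finite) set"
  assumes "affine L" "y \<in> L" "F differentiable (at y)" "x \<in> L" "x + w \<in> L" "norm w = 1"
  shows "\<bar>diff_form F y [w]\<bar> \<le> norm (gradient_on L F y)"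
proof -
  have "y + w \<in> L"
    using mem_affine_3_minus[OF assms(1,2,5,4), of 1] by simp
  then have "diff_form F y [w] = gradient_on L F y \<bullet> w"
    using gradient_on_projection(2)[OF assms(1-3)] by (simp add: gradient_inner_eq_diff_form)
  then show ?thesis
    using Cauchy_Schwarz_ineq2[of "gradient_on L F y" w] assms(6) by simp
qed

section \<open>The steepness inequality from a single good radius\<close>

lemma affine_sphere_nonempty:
  fixes L :: "'a::euclidean_space set"
  assumes "affine L" "x \<in> L" "aff_dim L \<ge> 1" "\<eta> \<ge> 0"
  shows "\<exists>y\<in>L. norm (x - y) = \<eta>"
proof -
  have "L \<noteq> {x}" using assms(3) by auto
  then obtain z where z: "z \<in> L" "z \<noteq> x" using assms(2) by blast
  define t where "t = \<eta> / norm (z - x)"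
  have "x + t *\<^sub>R (z - x) \<in> L"
    using affine_direction_scale[OF assms(1,2)] z by simp
  moreover have "norm (x - (x + t *\<^sub>R (z - x))) = \<eta>"
    using z assms(4) by (simp add: t_def)
  ultimately show ?thesis by blast
qed

text \<open>One good radius bounds the supremum of the infima from below, and the factor 2 makes the
  inequality strict. The rest secures what \<open>INF\<close> and \<open>SUP\<close> over the reals
  require: nonempty spheres and bounded gradients.\<close>

lemma steep_ineqI:
  fixes x :: "real^'n::finite"
  assumes f: "smooth_on A f" "open A" "cball x \<delta> \<subseteq> A" and m: "1 \<le> m" and C: "0 < C"
    and radius: "\<And>L \<xi>. \<lbrakk>affine L; aff_dim L = int m; x \<in> L; \<And>y. y \<in> L \<Longrightarrow> (y - x) \<bullet> gradient f x = 0;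
        0 < \<xi>; \<xi> \<le> \<delta>\<rbrakk> \<Longrightarrow> 
        \<exists>\<eta>. 0 \<le> \<eta> \<and> \<eta> \<le> \<xi> \<and> (\<forall>y\<in>L. norm (x - y) = \<eta> \<longrightarrow> 2 * C * \<xi> powr \<alpha> \<le> norm (gradient_on L f y))"
  shows "steep_ineq A f m C \<delta> \<alpha> x"
  unfolding steep_ineq_def
proof (intro conjI allI impI f(3))
  fix L \<xi>
  assume "affine L \<and> aff_dim L = int m \<and> x \<in> L \<and> (\<forall>y\<in>L. (y - x) \<bullet> gradient f x = 0)"
    and \<xi>: "0 < \<xi> \<and> \<xi> \<le> \<delta>"
  then have L: "affine L" "aff_dim L = int m" "x \<in> L" "\<And>y. y \<in> L \<Longrightarrow> (y - x) \<bullet> gradient f x = 0" by blast+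
  let ?Y = "\<lambda>\<eta>. {y \<in> L. norm (x - y) = \<eta>}"
  let ?m = "\<lambda>\<eta>. INF y\<in>?Y \<eta>. norm (gradient_on L f y)"
  obtain M where M: "M \<ge> 1"
    "\<And>y vs. y \<in> cball x \<delta> \<Longrightarrow> length vs \<le> 1 \<Longrightarrow> \<bar>diff_form f y vs\<bar> \<le> M * prod_list (map norm vs)"
    using diff_form_bound[OF f(1) compact_cball f(3), of 1] by blast
  have gM: "norm (gradient_on L f y) \<le> M" if "y \<in> L" "y \<in> cball x \<delta>" for y
  proof -
    \<comment> \<open>The derivative is evaluated on the gradient itself, which gives the square of
      its norm.\<close>
    have "norm (gradient f y) * norm (gradient f y) \<le> M * norm (gradient f y)"
      using M(2)[OF that(2), of "[gradient f y]"]
      by (simp flip: gradient_inner_eq_diff_form add: power2_norm_eq_inner[symmetric] power2_eq_square)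
    then have "norm (gradient f y) \<le> M"
      using M(1) by (metis mult_right_le_imp_le norm_ge_zero order_le_less order.strict_trans1 zero_less_one)
    moreover have "f differentiable (at y)"
      using smooth_on_differentiable[OF f(1,2), of y "[]"] that f(3) by auto
    ultimately show ?thesis using norm_gradient_on_le[OF L(1) that(1)] by fastforce
  qed
  have ne: "?Y \<eta> \<noteq> {}" if "0 \<le> \<eta>" for \<eta>
    using affine_sphere_nonempty[OF L(1,3) _ that] L(2) m by auto
  have bdd: "bdd_below ((\<lambda>y. norm (gradient_on L f y)) ` ?Y \<eta>)" for \<eta>
    by (rule bdd_belowI[of _ 0]) auto
  have bda: "bdd_above (?m ` {0..\<xi>})"
  proof (rule bdd_aboveI2)
    fix \<eta> assume \<eta>: "\<eta> \<in> {0..\<xi>}"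
    obtain y where y: "y \<in> ?Y \<eta>" using ne \<eta> by fastforce
    have "?m \<eta> \<le> norm (gradient_on L f y)" by (rule cINF_lower[OF bdd y])
    also have "\<dots> \<le> M" by (rule gM) (use y \<eta> \<xi> in \<open>auto simp: dist_norm\<close>)
    finally show "?m \<eta> \<le> M" .
  qed
  obtain \<eta> where \<eta>: "0 \<le> \<eta>" "\<eta> \<le> \<xi>" 
      "\<And>y. y \<in> L \<Longrightarrow> norm (x - y) = \<eta> \<Longrightarrow> 2 * C * \<xi> powr \<alpha> \<le> norm (gradient_on L f y)"
    using radius[OF L] \<xi> by blast
  have "C * \<xi> powr \<alpha> < 2 * C * \<xi> powr \<alpha>" using C \<xi> by simp
  also have "\<dots> \<le> ?m \<eta>" by (rule cINF_greatest[OF ne[OF \<eta>(1)]]) (use \<eta>(3) in auto)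
  also have "\<dots> \<le> (SUP \<eta>\<in>{0..\<xi>}. ?m \<eta>)" by (rule cSUP_upper[OF _ bda]) (use \<eta> in auto)
  finally show "C * \<xi> powr \<alpha> < (SUP \<eta>\<in>{0..\<xi>}. ?m \<eta>)" .
qed

section \<open>Orthonormal bases, diagonalization and uniform positivity\<close>

lemma affine_orthonormal_basis:
  fixes L :: "'a::euclidean_space set"
  assumes "affine L" "x \<in> L" "aff_dim L = int m"
  obtains B where "pairwise orthogonal B" "\<And>b. b \<in> B \<Longrightarrow> norm b = 1" "card B = m" "finite B"
    "\<And>y. y \<in> L \<longleftrightarrow> y - x \<in> span B"
proof -
  let ?S = "(\<lambda>y. y - x) ` L"
  obtain B where B: "pairwise orthogonal B" "\<And>b. b \<in> B \<Longrightarrow> norm b = 1" "independent B"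
      "card B = dim ?S" "span B = ?S"
    using orthonormal_basis_subspace[OF affine_diffs_subspace_subtract[OF assms(1,2)]] by metis
  moreover have "dim ?S = m" using aff_dim_dim_affine_diffs[OF assms(1,2)] assms(3) by simp
  moreover have "y \<in> L \<longleftrightarrow> y - x \<in> ?S" for y by auto
  ultimately show thesis using that independent_imp_finite by metis
qed

lemma affine_line:
  fixes L :: "'a::euclidean_space set"
  assumes "affine L" "x \<in> L" "aff_dim L = 1"
  obtains v where "norm v = 1" "\<And>y. y \<in> L \<longleftrightarrow> (\<exists>t. y = x + t *\<^sub>R v)"
proof -
  obtain B where B: "\<And>b. b \<in> B \<Longrightarrow> norm b = 1" "card B = 1" "\<And>y. y \<in> L \<longleftrightarrow> y - x \<in> span B"
    using affine_orthonormal_basis[of L x 1] assms by (metis of_nat_1)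
  obtain v where v: "B = {v}" using B(2) by (auto simp: card_1_singleton_iff)
  have "y \<in> L \<longleftrightarrow> (\<exists>t. y = x + t *\<^sub>R v)" for y
    by (auto simp: B(3) v span_singleton algebra_simps)
  then show thesis using that B(1) v by blast
qed

lemma affine_plane:
  fixes L :: "'a::euclidean_space set"
  assumes "affine L" "x \<in> L" "aff_dim L = 2"
  obtains p q where "norm p = 1" "norm q = 1" "p \<bullet> q = 0"
    "\<And>y. y \<in> L \<longleftrightarrow> (\<exists>s t. y = x + s *\<^sub>R p + t *\<^sub>R q)"
proof -
  obtain B where B: "pairwise orthogonal B" "\<And>b. b \<in> B \<Longrightarrow> norm b = 1" "card B = 2"
      "\<And>y. y \<in> L \<longleftrightarrow> y - x \<in> span B"
    using affine_orthonormal_basis[of L x 2] assms by (metis of_nat_numeral)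
  obtain p q where pq: "B = {p, q}" "p \<noteq> q" using B(3) by (auto simp: card_2_iff)
  have eq: "y - x - s *\<^sub>R p = t *\<^sub>R q \<longleftrightarrow> y = x + s *\<^sub>R p + t *\<^sub>R q" for y s t
    by (simp add: algebra_simps)
  have "y \<in> L \<longleftrightarrow> (\<exists>s t. y = x + s *\<^sub>R p + t *\<^sub>R q)" for y
    by (simp add: B(4) pq span_insert[of p] span_singleton image_iff eq)
  moreover have "p \<bullet> q = 0" using B(1) pq by (simp add: pairwise_def orthogonal_def)
  ultimately show thesis using that B(2) pq by blast
qed

text \<open>Rotating the basis by a quarter turn reverses the sign of the off-diagonal entry, so by
  the intermediate value theorem it vanishes at some angle. Exchanging the two vectors, if
  necessary, orders the diagonal entries.\<close>

lemma diagonalize_symmetric_form: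
  fixes p q :: "'a::real_inner" and B :: "'a \<Rightarrow> 'a \<Rightarrow> real"
  assumes pq: "norm p = 1" "norm q = 1" "p \<bullet> q = 0"
    and lin: "\<And>a b u v w. B (a *\<^sub>R u + b *\<^sub>R v) w = a * B u w + b * B v w"
    and sym: "\<And>u v. B u v = B v u"
  obtains v e where "norm v = 1" "norm e = 1" "v \<bullet> e = 0" "B v e = 0" "\<bar>B v v\<bar> \<le> \<bar>B e e\<bar>"
    "\<forall>y. (\<exists>s t. y = s *\<^sub>R p + t *\<^sub>R q) \<longleftrightarrow> (\<exists>s t. y = s *\<^sub>R v + t *\<^sub>R e)"
proof -
  define V where "V = (\<lambda>\<theta>. cos \<theta> *\<^sub>R p + sin \<theta> *\<^sub>R q)"
  define E where "E = (\<lambda>\<theta>. (- sin \<theta>) *\<^sub>R p + cos \<theta> *\<^sub>R q)"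
  have lin2: "B w (a *\<^sub>R u + b *\<^sub>R v) = a * B w u + b * B w v" for a b u v w
    using lin[of a u b v w] by (simp add: sym)
  let ?f = "\<lambda>\<theta>. B (V \<theta>) (E \<theta>)"
  have f: "?f \<theta> = (cos \<theta> * cos \<theta> - sin \<theta> * sin \<theta>) * B p q + cos \<theta> * sin \<theta> * (B q q - B p p)" for \<theta>
    unfolding V_def E_def lin lin2 by (simp add: sym[of q p] algebra_simps)
  have "continuous_on UNIV ?f" unfolding f by (intro continuous_intros)
  moreover have "?f (pi/2) = - ?f 0" by (simp add: f)
  ultimately obtain \<theta> where \<theta>: "?f \<theta> = 0"
  proof -
    assume c: "continuous_on UNIV ?f" and m: "?f (pi/2) = - ?f 0"
      and *: "\<And>\<theta>. ?f \<theta> = 0 \<Longrightarrow> thesis"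
    have cc: "continuous_on {0..pi/2} ?f" using c continuous_on_subset by blast
    show thesis
    proof (cases "?f 0 \<le> 0")
      case True
      then show ?thesis using IVT'[of ?f 0 0 "pi/2"] cc m * by auto
    next
      case False
      then show ?thesis using IVT2'[of ?f "pi/2" 0 0] cc m * by auto
    qed
  qed
  have cs: "cos \<theta> * cos \<theta> + sin \<theta> * sin \<theta> = 1" using sin_cos_squared_add3 by simp
  have pp: "p \<bullet> p = 1" "q \<bullet> q = 1" "q \<bullet> p = 0"
    using pq by (simp_all add: norm_eq_1 inner_commute)
  have n: "norm (V \<theta>) = 1" "norm (E \<theta>) = 1" "V \<theta> \<bullet> E \<theta> = 0"
    using cs by (simp_all add: norm_eq_1 V_def E_def inner_add_left inner_add_right pp pq(3) algebra_simps)
  \<comment> \<open>These are the coefficients of the inverse rotation, so both bases span the same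
    plane.\<close>
  have rot: "(s * c + t * k) *\<^sub>R (c *\<^sub>R p + k *\<^sub>R q) + (t * c - s * k) *\<^sub>R ((- k) *\<^sub>R p + c *\<^sub>R q)
      = (s * (c * c + k * k)) *\<^sub>R p + (t * (c * c + k * k)) *\<^sub>R q" for s t c k
    by (simp add: algebra_simps)
  have span: "(\<exists>s t. y = s *\<^sub>R p + t *\<^sub>R q) \<longleftrightarrow> (\<exists>s t. y = s *\<^sub>R V \<theta> + t *\<^sub>R E \<theta>)" for y
  proof
    assume "\<exists>s t. y = s *\<^sub>R p + t *\<^sub>R q"
    then obtain s t where y: "y = s *\<^sub>R p + t *\<^sub>R q" by blast
    have "(s * cos \<theta> + t * sin \<theta>) *\<^sub>R V \<theta> + (t * cos \<theta> - s * sin \<theta>) *\<^sub>R E \<theta>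
        = (s * (cos \<theta> * cos \<theta> + sin \<theta> * sin \<theta>)) *\<^sub>R p + (t * (cos \<theta> * cos \<theta> + sin \<theta> * sin \<theta>)) *\<^sub>R q"
      unfolding V_def E_def by (rule rot)
    then show "\<exists>s t. y = s *\<^sub>R V \<theta> + t *\<^sub>R E \<theta>" using y cs by (metis mult.right_neutral)
  next
    assume "\<exists>s t. y = s *\<^sub>R V \<theta> + t *\<^sub>R E \<theta>"
    then obtain s t where y: "y = s *\<^sub>R V \<theta> + t *\<^sub>R E \<theta>" by blast
    have "y = (s * cos \<theta> - t * sin \<theta>) *\<^sub>R p + (s * sin \<theta> + t * cos \<theta>) *\<^sub>R q"
      unfolding y V_def E_def by (simp add: algebra_simps)
    then show "\<exists>s t. y = s *\<^sub>R p + t *\<^sub>R q" by blast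
  qed
  show thesis
  proof (cases "\<bar>B (V \<theta>) (V \<theta>)\<bar> \<le> \<bar>B (E \<theta>) (E \<theta>)\<bar>")
    case True
    then show ?thesis using that n \<theta> span by blast
  next
    case False
    have "(\<exists>s t. y = s *\<^sub>R V \<theta> + t *\<^sub>R E \<theta>) \<longleftrightarrow> (\<exists>s t. y = s *\<^sub>R E \<theta> + t *\<^sub>R V \<theta>)" for y
      by (metis add.commute)
    then show ?thesis using that[of "E \<theta>" "V \<theta>"] False n \<theta> span sym[of "E \<theta>" "V \<theta>"]
      by (simp add: inner_commute)
  qed
qed

text \<open>Turns positivity at the single point \<open>x0\<close> into a uniform lower bound:
  \<open>F\<close> has a positive minimum over the compact \<open>K\<close>, and by uniform
  continuity at most half of it is lost near \<open>x0\<close>.\<close>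

lemma compact_positive_nearby:
  fixes F :: "'a::{heine_borel,real_normed_vector} \<times> 'b::metric_space \<Rightarrow> real"
  assumes "compact K" "r > 0" "continuous_on (cball x0 r \<times> K) F"
    and pos: "\<And>k. k \<in> K \<Longrightarrow> F (x0, k) > 0"
  obtains c d where "c > 0" "0 < d" "d \<le> r" "\<And>x k. x \<in> cball x0 d \<Longrightarrow> k \<in> K \<Longrightarrow> c \<le> F (x, k)"
proof (cases "K = {}")
  case True
  then show ?thesis using that[of 1 r] assms(2) by simp
next
  case False
  have cont: "continuous_on ({x0} \<times> K) F"
    using assms(2) by (intro continuous_on_subset[OF assms(3)]) auto
  have cpt: "compact ({x0} \<times> K)" "{x0} \<times> K \<noteq> {}"
    using assms(1) False by (auto intro: compact_Times)
  obtain p where p: "p \<in> {x0} \<times> K" "\<forall>p'\<in>{x0} \<times> K. F p \<le> F p'"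
    using continuous_attains_inf[OF cpt cont] by blast
  define c where "c = F p / 2"
  have c: "c > 0" using p(1) pos by (auto simp: c_def)
  have c2: "2 * c \<le> F (x0, k)" if "k \<in> K" for k
    using p(2) that by (simp add: c_def)
  have "compact (cball x0 r \<times> K)" using assms(1) by (simp add: compact_Times)
  then have "uniformly_continuous_on (cball x0 r \<times> K) F"
    by (rule compact_uniformly_continuous[OF assms(3)])
  then obtain d where d: "d > 0" "\<forall>p\<in>cball x0 r \<times> K. \<forall>p'\<in>cball x0 r \<times> K. dist p' p < d \<longrightarrow> dist (F p') (F p) < c"
    unfolding uniformly_continuous_on_def using c by blast
  define d' where "d' = min r (d / 2)"
  have "c \<le> F (x, k)" if "x \<in> cball x0 d'" "k \<in> K" for x k
  proof -
    have "dist (F (x, k)) (F (x0, k)) < c"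
      using d(2)[rule_format, of "(x0, k)" "(x, k)"] that assms(2) d(1)
      by (simp add: d'_def dist_Pair_Pair dist_commute)
    then show ?thesis using c2[OF that(2)] by (simp add: dist_real_def)
  qed
  then show ?thesis using that[of c d'] c d(1) assms(2) by (simp add: d'_def)
qed

section \<open>Elementary estimates\<close>

lemma divided_difference_bound:
  fixes p q s t :: real
  assumes "\<bar>p\<bar> \<le> \<omega>" "\<bar>q\<bar> \<le> \<omega>" "1/8 \<le> \<bar>s - t\<bar>" "p - q = d * (s - t)"
  shows "\<bar>d\<bar> \<le> 16 * \<omega>"
proof -
  have "\<bar>d\<bar> * (1/8) \<le> \<bar>d\<bar> * \<bar>s - t\<bar>" by (intro mult_left_mono assms(3)) simp
  also have "\<dots> = \<bar>p - q\<bar>" by (simp add: assms(4) abs_mult)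
  finally show ?thesis using assms(1,2) by linarith
qed

text \<open>Newton's divided differences: since the nodes are at least 1/8 apart, each order costs a
  factor 16, and the third divided difference is \<open>c3\<close>. Back substitution then bounds
  \<open>c2\<close>, \<open>c1\<close> and \<open>c0\<close>; the largest factor that occurs is
  54033.\<close>

lemma cubic_coefficient_bound_unit:
  fixes s :: "nat \<Rightarrow> real"
  assumes s: "\<And>i. i < 4 \<Longrightarrow> \<bar>s i\<bar> \<le> 1" "\<And>i j. i < j \<Longrightarrow> j < 4 \<Longrightarrow> 1/8 \<le> \<bar>s i - s j\<bar>"
    and q: "\<And>i. i < 4 \<Longrightarrow> \<bar>c0 + c1 * s i + c2 * (s i)\<^sup>2 + c3 * (s i)^3\<bar> \<le> \<omega>"
  shows "\<bar>c0\<bar> \<le> 60000 * \<omega>" "\<bar>c1\<bar> \<le> 60000 * \<omega>" "\<bar>c2\<bar> \<le> 60000 * \<omega>" "\<bar>c3\<bar> \<le> 60000 * \<omega>"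
proof -
  have \<omega>: "0 \<le> \<omega>" using q[of 0] by linarith
  define d1 where "d1 = (\<lambda>i j. c1 + c2 * (s i + s j) + c3 * ((s i)\<^sup>2 + s i * s j + (s j)\<^sup>2))"
  have d1: "\<bar>d1 i j\<bar> \<le> 16 * \<omega>" if "i < j" "j < 4" for i j
  proof (rule divided_difference_bound[OF q[of i] q[of j] s(2)])
    show "c0 + c1 * s i + c2 * (s i)\<^sup>2 + c3 * (s i)^3 - (c0 + c1 * s j + c2 * (s j)\<^sup>2 + c3 * (s j)^3)
        = d1 i j * (s i - s j)"
      unfolding d1_def by algebra
  qed (use that in auto)
  define d2 where "d2 = (\<lambda>i j k. c2 + c3 * (s i + s j + s k))"
  have d2: "\<bar>d2 i j k\<bar> \<le> 256 * \<omega>" if "i < j" "j < k" "k < 4" for i j k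
    using divided_difference_bound[OF d1[of i j] d1[of j k] s(2)[of i k], of "d2 i j k"] that
    by (simp add: d1_def d2_def algebra_simps power2_eq_square)
  have d3: "\<bar>c3\<bar> \<le> 4096 * \<omega>"
    using divided_difference_bound[OF d2[of 0 1 2] d2[of 1 2 3] s(2)[of 0 3], of c3]
    by (simp add: d2_def algebra_simps)
  have le: "\<bar>x * y\<bar> \<le> B * N" if "\<bar>x\<bar> \<le> B" "\<bar>y\<bar> \<le> N" for x y B N :: real
    using mult_mono[OF that] that by (simp add: abs_mult)
  have s0: "\<bar>s 0\<bar> \<le> 1" "\<bar>s 1\<bar> \<le> 1" "\<bar>s 2\<bar> \<le> 1" using s(1) by simp_all
  have "\<bar>c3 * (s 0 + s 1 + s 2)\<bar> \<le> 4096 * \<omega> * 3"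
    by (intro le d3) (use s0 in linarith)
  moreover have "\<bar>c2 + c3 * (s 0 + s 1 + s 2)\<bar> \<le> 256 * \<omega>" using d2[of 0 1 2] by (simp add: d2_def)
  ultimately have c2: "\<bar>c2\<bar> \<le> 12544 * \<omega>" by linarith
  have sq: "\<bar>(s 0)\<^sup>2\<bar> \<le> 1" "\<bar>s 0 * s 1\<bar> \<le> 1" "\<bar>(s 1)\<^sup>2\<bar> \<le> 1" "\<bar>(s 0)^3\<bar> \<le> 1"
    using le[OF s0(1) s0(1)] le[OF s0(1) s0(2)] le[OF s0(2) s0(2)] power_le_one[of "\<bar>s 0\<bar>" 3] s0
    by (simp_all add: power2_eq_square power_abs)
  have "\<bar>c3 * ((s 0)\<^sup>2 + s 0 * s 1 + (s 1)\<^sup>2)\<bar> \<le> 4096 * \<omega> * 3"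
    by (intro le d3) (use sq in linarith)
  moreover have "\<bar>c2 * (s 0 + s 1)\<bar> \<le> 12544 * \<omega> * 2"
    by (intro le c2) (use s0 in linarith)
  moreover have "\<bar>c1 + c2 * (s 0 + s 1) + c3 * ((s 0)\<^sup>2 + s 0 * s 1 + (s 1)\<^sup>2)\<bar> \<le> 16 * \<omega>"
    using d1[of 0 1] by (simp add: d1_def)
  ultimately have c1: "\<bar>c1\<bar> \<le> 37392 * \<omega>" by linarith
  have "\<bar>c1 * s 0\<bar> \<le> 37392 * \<omega> * 1" "\<bar>c2 * (s 0)\<^sup>2\<bar> \<le> 12544 * \<omega> * 1" "\<bar>c3 * (s 0)^3\<bar> \<le> 4096 * \<omega> * 1"
    using le[OF c1 s0(1)] le[OF c2 sq(1)] le[OF d3 sq(4)] by simp_all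
  then have "\<bar>c0\<bar> \<le> 54033 * \<omega>" using q[of 0] by linarith
  then show "\<bar>c0\<bar> \<le> 60000 * \<omega>" "\<bar>c1\<bar> \<le> 60000 * \<omega>" "\<bar>c2\<bar> \<le> 60000 * \<omega>" "\<bar>c3\<bar> \<le> 60000 * \<omega>"
    using \<omega> c1 c2 d3 by linarith+
qed

text \<open>Prescribing only the moduli of the nodes \<open>s i\<close> suffices: whatever the signs, the nodes stay separated.\<close>

lemma cubic_coefficient_bound:
  fixes s :: "nat \<Rightarrow> real"
  assumes \<xi>: "0 < \<xi>"
    and s: "\<And>i. i < 4 \<Longrightarrow> real (Suc i) * \<xi> / 4 - \<xi> / 16 \<le> \<bar>s i\<bar>" "\<And>i. i < 4 \<Longrightarrow> \<bar>s i\<bar> \<le> real (Suc i) * \<xi> / 4"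
    and q: "\<And>i. i < 4 \<Longrightarrow> \<bar>c0 + c1 * s i + c2 * (s i)\<^sup>2 + c3 * (s i)^3\<bar> \<le> \<omega>"
  shows "\<bar>c0\<bar> \<le> 60000 * \<omega>" "\<bar>c1\<bar> * \<xi> \<le> 60000 * \<omega>" "\<bar>c2\<bar> * \<xi>\<^sup>2 \<le> 60000 * \<omega>" "\<bar>c3\<bar> * \<xi>^3 \<le> 60000 * \<omega>"
proof -
  define r where "r = (\<lambda>i. s i / \<xi>)"
  have sr: "s i = \<xi> * r i" for i using \<xi> by (simp add: r_def)
  have abs: "\<bar>s i\<bar> = \<xi> * \<bar>r i\<bar>" for i using \<xi> by (simp add: sr abs_mult)
  have lo: "real (Suc i) / 4 - 1 / 16 \<le> \<bar>r i\<bar>" if "i < 4" for i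
  proof -
    have "\<xi> * (real (Suc i) / 4 - 1 / 16) \<le> \<xi> * \<bar>r i\<bar>" using s(1)[OF that] by (simp add: abs algebra_simps)
    then show ?thesis using \<xi> mult_le_cancel_left_pos by blast
  qed
  have hi: "\<bar>r i\<bar> \<le> real (Suc i) / 4" if "i < 4" for i
  proof -
    have "\<xi> * \<bar>r i\<bar> \<le> \<xi> * (real (Suc i) / 4)" using s(2)[OF that] by (simp add: abs algebra_simps)
    then show ?thesis using \<xi> mult_le_cancel_left_pos by blast
  qed
  have 1: "\<bar>r i\<bar> \<le> 1" if "i < 4" for i
  proof -
    have "real (Suc i) \<le> real 4" using that by (intro of_nat_mono) simp
    then have "real (Suc i) / 4 \<le> 1" by (simp del: of_nat_Suc)
    with hi[OF that] show ?thesis by (rule order_trans)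
  qed
  \<comment> \<open>Consecutive radii differ by a quarter and the lower bound gives away 1/16, so
    the moduli of the rescaled nodes differ by at least 3/16. Opposite signs only increase the
    distance.\<close>
  have 2: "1/8 \<le> \<bar>r i - r j\<bar>" if "i < j" "j < 4" for i j
  proof -
    have "real (Suc i) + 1 \<le> real (Suc j)" using that by simp
    moreover have "1/8 \<le> \<bar>x - y\<bar>" if "A + 1 \<le> B" "\<bar>x\<bar> \<le> A / 4" "B / 4 - 1/16 \<le> \<bar>y\<bar>" for A B x y :: real
      using that by linarith
    ultimately show ?thesis using hi[OF less_trans[OF that]] lo[OF that(2)] by blast
  qed
  have 3: "\<bar>c0 + (c1 * \<xi>) * r i + (c2 * \<xi>\<^sup>2) * (r i)\<^sup>2 + (c3 * \<xi>^3) * (r i)^3\<bar> \<le> \<omega>" if "i < 4" for i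
    using q[OF that] by (simp add: sr power_mult_distrib mult.assoc)
  show "\<bar>c0\<bar> \<le> 60000 * \<omega>" "\<bar>c1\<bar> * \<xi> \<le> 60000 * \<omega>" "\<bar>c2\<bar> * \<xi>\<^sup>2 \<le> 60000 * \<omega>" "\<bar>c3\<bar> * \<xi>^3 \<le> 60000 * \<omega>"
    using cubic_coefficient_bound_unit[OF 1 2 3] \<xi> by (simp_all add: abs_mult)
qed

text \<open>Elimination of \<open>t\<close>: the second inequality gives \<open>t = - b s\<^sup>2 / (2 \<mu>)\<close> up to higher order,
  and substituting it into the first turns the quartic coefficient into \<open>\<mu> e / 6 - b\<^sup>2 / 2\<close>.\<close>

lemma eliminate_transversal:
  fixes \<mu> \<epsilon> a b d e s t \<xi> \<kappa> M :: real
  assumes M: "1 \<le> M" and bnd: "\<bar>\<mu>\<bar> \<le> M" "\<bar>b\<bar> \<le> M" "\<bar>b1\<bar> \<le> 2 * M" "\<bar>b2\<bar> \<le> M" "\<bar>d\<bar> \<le> M"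
    and \<mu>: "\<mu> \<noteq> 0" and \<xi>: "0 < \<xi>" "\<xi> \<le> 1" and st: "\<bar>s\<bar> \<le> \<xi>" "\<bar>t\<bar> \<le> \<xi>" and \<kappa>: "0 \<le> \<kappa>" "\<kappa> \<le> \<xi>^3"
    and ev: "\<bar>\<epsilon> * s + (a * s\<^sup>2 + 2 * b * s * t + d * t\<^sup>2) / 2 + e * s^3 / 6\<bar> \<le> \<kappa> + M * (\<bar>t\<bar> * \<xi>\<^sup>2 + \<xi>^4)"
    and ee: "\<bar>\<mu> * t + (b * s\<^sup>2 + b1 * s * t + b2 * t\<^sup>2) / 2\<bar> \<le> \<kappa> + M * \<xi>^3"
  shows "\<bar>\<mu>\<bar> * \<bar>t\<bar> \<le> 4 * M * \<xi>\<^sup>2"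
    and "\<bar>\<mu>\<bar> * \<bar>\<mu> * \<epsilon> * s + \<mu> * a / 2 * s\<^sup>2 + (\<mu> * e / 6 - b\<^sup>2 / 2) * s^3\<bar>
      \<le> \<mu>\<^sup>2 * \<kappa> + M * \<xi> * \<bar>\<mu>\<bar> * \<kappa> + 24 * M^3 * \<xi>^4"
proof -
  have le: "\<bar>x * y\<bar> \<le> B * N" if "\<bar>x\<bar> \<le> B" "\<bar>y\<bar> \<le> N" for x y B N :: real
    using mult_mono[OF that] that by (simp add: abs_mult)
  have le2: "x * y \<le> B * N" if "x \<le> B" "y \<le> N" "0 \<le> x" "0 \<le> y" for x y B N :: real
    using mult_mono[OF that(1,2)] that by simp
  have \<xi>3: "\<xi>^3 \<le> \<xi>\<^sup>2" using power_decreasing[of 2 3 \<xi>] \<xi> by simp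
  have M\<xi>3: "\<xi>^3 \<le> M * \<xi>\<^sup>2" "M * \<xi>^3 \<le> M * \<xi>\<^sup>2"
    using mult_left_mono[OF \<xi>3, of M] mult_right_mono[OF M, of "\<xi>\<^sup>2"] \<xi>3 M by simp_all
  have "\<bar>s\<^sup>2\<bar> \<le> \<xi>\<^sup>2" "\<bar>s * t\<bar> \<le> \<xi>\<^sup>2" "\<bar>t\<^sup>2\<bar> \<le> \<xi>\<^sup>2"
    using le[OF st(1) st(1)] le[OF st] le[OF st(2) st(2)] by (simp_all add: power2_eq_square)
  then have A: "\<bar>b * s\<^sup>2\<bar> \<le> M * \<xi>\<^sup>2" "\<bar>b1 * (s * t)\<bar> \<le> 2 * M * \<xi>\<^sup>2" "\<bar>b2 * t\<^sup>2\<bar> \<le> M * \<xi>\<^sup>2"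
    using le[OF bnd(2)] le[OF bnd(3)] le[OF bnd(4)] by blast+
  have tri: "\<bar>x\<bar> \<le> k + (P + Q + R) / 2"
    if "x = U - p / 2 - q / 2 - r / 2" "\<bar>U\<bar> \<le> k" "\<bar>p\<bar> \<le> P" "\<bar>q\<bar> \<le> Q" "\<bar>r\<bar> \<le> R"
    for x U k p q r P Q R :: real
  proof (rule abs_leI)
    note le = that(1) abs_le_D1[OF that(2)] abs_le_D1[OF that(3)] abs_le_D1[OF that(4)] abs_le_D1[OF that(5)]
      abs_le_D2[OF that(2)] abs_le_D2[OF that(3)] abs_le_D2[OF that(4)] abs_le_D2[OF that(5)]
    show "x \<le> k + (P + Q + R) / 2" "- x \<le> k + (P + Q + R) / 2" using le by argo+
  qed
  \<comment> \<open>A crude first bound: all quadratic terms are estimated by multiples of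
    \<open>\<xi>\<^sup>2\<close>.\<close>
  have "\<bar>\<mu> * t\<bar> \<le> (\<kappa> + M * \<xi>^3) + (M * \<xi>\<^sup>2 + 2 * M * \<xi>\<^sup>2 + M * \<xi>\<^sup>2) / 2"
    by (rule tri[OF _ ee A]) (simp add: field_simps)
  also have "\<dots> \<le> 4 * M * \<xi>\<^sup>2" using M\<xi>3 \<kappa> by simp
  finally show T: "\<bar>\<mu>\<bar> * \<bar>t\<bar> \<le> 4 * M * \<xi>\<^sup>2" by (simp add: abs_mult)

  let ?l = "\<bar>\<mu>\<bar>"
  define X where "X = \<epsilon> * s + (a * s\<^sup>2 + 2 * b * s * t + d * t\<^sup>2) / 2 + e * s^3 / 6"
  define Y where "Y = \<mu> * t + b * s\<^sup>2 / 2"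
  \<comment> \<open>Terms containing \<open>t\<close> now keep the factor
    \<open>\<bar>t\<bar>\<close>. Multiplied by \<open>?l\<close> they become of order
    \<open>\<xi>^3\<close> by the crude bound, one order better than before.\<close>
  have st\<xi>: "\<bar>s * t\<bar> \<le> \<xi> * \<bar>t\<bar>" "\<bar>t\<^sup>2\<bar> \<le> \<xi> * \<bar>t\<bar>"
    using mult_right_mono[OF st(1), of "\<bar>t\<bar>"] mult_right_mono[OF st(2), of "\<bar>t\<bar>"]
    by (simp_all add: abs_mult power2_eq_square)
  have "\<bar>Y\<bar> \<le> (\<kappa> + M * \<xi>^3) + (0 + 2 * M * (\<xi> * \<bar>t\<bar>) + M * (\<xi> * \<bar>t\<bar>)) / 2"
    by (rule tri[OF _ ee, of _ 0 "b1 * (s * t)" "b2 * t\<^sup>2"])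
      (use le[OF bnd(3) st\<xi>(1)] le[OF bnd(4) st\<xi>(2)] in \<open>auto simp: Y_def field_simps\<close>)
  also have "\<dots> \<le> \<kappa> + M * \<xi>^3 + 2 * M * (\<xi> * \<bar>t\<bar>)" using M \<xi> by simp
  finally have "\<bar>Y\<bar> \<le> \<kappa> + M * \<xi>^3 + 2 * M * (\<xi> * \<bar>t\<bar>)" .
  then have "?l * \<bar>Y\<bar> \<le> ?l * (\<kappa> + M * \<xi>^3 + 2 * M * (\<xi> * \<bar>t\<bar>))" by (simp add: mult_left_mono)
  also have "\<dots> = ?l * \<kappa> + ?l * (M * \<xi>^3) + (2 * M * \<xi>) * (?l * \<bar>t\<bar>)" by (simp add: algebra_simps)
  also have "\<dots> \<le> ?l * \<kappa> + M * (M * \<xi>^3) + (2 * M * \<xi>) * (4 * M * \<xi>\<^sup>2)"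
    using M \<xi> by (intro add_mono mult_right_mono mult_left_mono bnd T) auto
  also have "\<dots> = ?l * \<kappa> + 9 * M\<^sup>2 * \<xi>^3" by (simp add: power2_eq_square power3_eq_cube)
  finally have lY: "?l * \<bar>Y\<bar> \<le> ?l * \<kappa> + 9 * M\<^sup>2 * \<xi>^3" .

  \<comment> \<open>Subtracting \<open>b * s * Y\<close> removes the mixed term of
    \<open>\<mu> * X\<close> and creates the coefficient with \<open>b\<^sup>2\<close>. A further
    factor \<open>?l\<close> is carried below because the remainder with \<open>t\<^sup>2\<close>
    uses the bound on \<open>?l * \<bar>t\<bar>\<close> twice.\<close>
  have P: "\<mu> * \<epsilon> * s + \<mu> * a / 2 * s\<^sup>2 + (\<mu> * e / 6 - b\<^sup>2 / 2) * s^3 = \<mu> * X - b * s * Y - \<mu> * (d * t\<^sup>2) / 2"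
    by (simp add: X_def Y_def field_simps power2_eq_square power3_eq_cube)
  have \<mu>2: "\<mu>\<^sup>2 = ?l * ?l" by (simp add: power2_eq_square)
  have "?l * \<bar>\<mu> * X\<bar> = \<mu>\<^sup>2 * \<bar>X\<bar>" by (simp only: abs_mult \<mu>2 mult.assoc)
  also have "\<dots> \<le> \<mu>\<^sup>2 * (\<kappa> + M * (\<bar>t\<bar> * \<xi>\<^sup>2 + \<xi>^4))"
    using ev by (intro mult_left_mono) (simp_all add: X_def)
  also have "\<dots> = \<mu>\<^sup>2 * \<kappa> + (?l * M * \<xi>\<^sup>2) * (?l * \<bar>t\<bar>) + \<mu>\<^sup>2 * (M * \<xi>^4)"
    unfolding \<mu>2 by algebra
  also have "\<dots> \<le> \<mu>\<^sup>2 * \<kappa> + (M * M * \<xi>\<^sup>2) * (4 * M * \<xi>\<^sup>2) + (M * M) * (M * \<xi>^4)"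
  proof -
    have "(?l * M * \<xi>\<^sup>2) * (?l * \<bar>t\<bar>) \<le> (M * M * \<xi>\<^sup>2) * (4 * M * \<xi>\<^sup>2)"
      using M by (intro mult_mono[OF _ T] mult_right_mono bnd(1)) auto
    moreover have "\<mu>\<^sup>2 * (M * \<xi>^4) \<le> (M * M) * (M * \<xi>^4)"
      unfolding \<mu>2 using M by (intro mult_right_mono mult_mono bnd(1)) auto
    ultimately show ?thesis by linarith
  qed
  also have "\<dots> = \<mu>\<^sup>2 * \<kappa> + 5 * M^3 * \<xi>^4"
    by (simp add: algebra_simps power2_eq_square power3_eq_cube power4_eq_xxxx)
  finally have 1: "?l * \<bar>\<mu> * X\<bar> \<le> \<mu>\<^sup>2 * \<kappa> + 5 * M^3 * \<xi>^4" .
  have "?l * \<bar>b * s * Y\<bar> = (\<bar>b\<bar> * \<bar>s\<bar>) * (?l * \<bar>Y\<bar>)" by (simp add: abs_mult)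
  also have "\<dots> \<le> (M * \<xi>) * (?l * \<kappa> + 9 * M\<^sup>2 * \<xi>^3)"
    using M \<xi> by (intro mult_mono bnd(2) st lY) auto
  also have "\<dots> = M * \<xi> * ?l * \<kappa> + 9 * M^3 * \<xi>^4"
    by (simp add: algebra_simps power2_eq_square power3_eq_cube power4_eq_xxxx)
  finally have 2: "?l * \<bar>b * s * Y\<bar> \<le> M * \<xi> * ?l * \<kappa> + 9 * M^3 * \<xi>^4" .
  have "?l * \<bar>\<mu> * (d * t\<^sup>2) / 2\<bar> = \<bar>d\<bar> * ((?l * \<bar>t\<bar>) * (?l * \<bar>t\<bar>)) / 2"
    by (simp add: abs_mult power2_eq_square)
  also have "\<dots> \<le> M * ((4 * M * \<xi>\<^sup>2) * (4 * M * \<xi>\<^sup>2)) / 2"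
    using M by (intro divide_right_mono le2 bnd(5) T) auto
  also have "\<dots> = 8 * M^3 * \<xi>^4"
    by (simp add: power2_eq_square power3_eq_cube power4_eq_xxxx)
  finally have 3: "?l * \<bar>\<mu> * (d * t\<^sup>2) / 2\<bar> \<le> 8 * M^3 * \<xi>^4" .
  have "?l * \<bar>\<mu> * X - b * s * Y - \<mu> * (d * t\<^sup>2) / 2\<bar>
      \<le> ?l * (\<bar>\<mu> * X\<bar> + \<bar>b * s * Y\<bar> + \<bar>\<mu> * (d * t\<^sup>2) / 2\<bar>)"
    by (intro mult_left_mono) linarith+
  also have "\<dots> \<le> \<mu>\<^sup>2 * \<kappa> + M * \<xi> * ?l * \<kappa> + 22 * M^3 * \<xi>^4"
    using 1 2 3 by (simp add: distrib_left)
  also have "\<dots> \<le> \<mu>\<^sup>2 * \<kappa> + M * \<xi> * ?l * \<kappa> + 24 * M^3 * \<xi>^4"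
    using M \<xi> by simp
  finally show "\<bar>\<mu>\<bar> * \<bar>\<mu> * \<epsilon> * s + \<mu> * a / 2 * s\<^sup>2 + (\<mu> * e / 6 - b\<^sup>2 / 2) * s^3\<bar>
      \<le> \<mu>\<^sup>2 * \<kappa> + M * \<xi> * \<bar>\<mu>\<bar> * \<kappa> + 24 * M^3 * \<xi>^4" unfolding P .
qed

text \<open>Elimination of \<open>t i\<close> and division by \<open>s i\<close> leave a quadratic
  polynomial in \<open>s i\<close> that is small at four nodes. As \<xi> is small compared with
  \<mu>, each \<open>t i\<close> is at most \<xi> / 16 in modulus; hence the nodes are separated and
  the coefficients are small. The conclusion is what nondegeneracy will contradict.\<close>

lemma critical_points_at_four_radii:
  fixes \<mu> \<epsilon> a b d e \<xi> M c0 :: real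
  assumes M: "1 \<le> M" and bnd: "\<bar>\<mu>\<bar> \<le> M" "\<bar>b\<bar> \<le> M" "\<bar>b1\<bar> \<le> 2 * M" "\<bar>b2\<bar> \<le> M" "\<bar>d\<bar> \<le> M"
    and c0: "0 < c0" "c0 \<le> 1" and \<xi>: "0 < \<xi>" "\<xi> \<le> 1" "\<xi> \<le> c0 / (10^8 * M^3) * \<bar>\<mu>\<bar>"
    and \<kappa>: "0 \<le> \<kappa>" "\<kappa> \<le> c0 / (10^8 * M) * \<xi>^3"
    and st: "\<And>i. i < (4::nat) \<Longrightarrow> (s i)\<^sup>2 + (t i)\<^sup>2 = (real (Suc i) * \<xi> / 4)\<^sup>2"
    and ev: "\<And>i. i < 4 \<Longrightarrow> \<bar>\<epsilon> * s i + (a * (s i)\<^sup>2 + 2 * b * s i * t i + d * (t i)\<^sup>2) / 2 + e * (s i)^3 / 6\<bar>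
        \<le> \<kappa> + M * (\<bar>t i\<bar> * \<xi>\<^sup>2 + \<xi>^4)"
    and ee: "\<And>i. i < 4 \<Longrightarrow> \<bar>\<mu> * t i + (b * (s i)\<^sup>2 + b1 * s i * t i + b2 * (t i)\<^sup>2) / 2\<bar> \<le> \<kappa> + M * \<xi>^3"
  shows "\<bar>\<mu> * \<epsilon>\<bar> + \<bar>a\<bar> + \<bar>\<mu> * e / 6 - b\<^sup>2 / 2\<bar> < c0"
proof -
  let ?l = "\<bar>\<mu>\<bar>"
  define D where "D = \<mu> * e / 6 - b\<^sup>2 / 2"
  have M3: "1 \<le> M^3" "M \<le> M^3" using M power_increasing[of 1 3 M] by simp_all
  have l: "0 < ?l" using \<xi> by (cases "\<mu> = 0") auto
  then have \<mu>: "\<mu> \<noteq> 0" by simp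
  have \<sigma>: "10^8 * (M^3 * \<xi>) \<le> c0 * ?l" using \<xi>(3) M by (simp add: field_simps)
  have \<kappa>': "10^8 * (M * \<kappa>) \<le> c0 * \<xi>^3" using \<kappa>(2) M by (simp add: field_simps)
  have \<kappa>\<xi>: "\<kappa> \<le> \<xi>^3"
  proof -
    have "\<kappa> \<le> 10^8 * (M * \<kappa>)" using M \<kappa>(1) by (simp add: mult_le_cancel_right1 flip: mult.assoc)
    also have "\<dots> \<le> c0 * \<xi>^3" by (rule \<kappa>')
    also have "\<dots> \<le> \<xi>^3" using c0 \<xi> by (simp add: mult_left_le_one_le)
    finally show ?thesis .
  qed
  have \<xi>l: "\<xi> \<le> ?l"
  proof -
    have "\<xi> \<le> 10^8 * (M^3 * \<xi>)" using M3 \<xi>(1) by (simp add: mult_le_cancel_right1 flip: mult.assoc)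
    also have "\<dots> \<le> c0 * ?l" by (rule \<sigma>)
    also have "\<dots> \<le> ?l" using c0 by (simp add: mult_left_le_one_le)
    finally show ?thesis .
  qed
  have rad: "real (Suc i) * \<xi> / 4 \<le> \<xi>" if "i < 4" for i
  proof -
    have "real (Suc i) * \<xi> \<le> 4 * \<xi>" using that \<xi>(1) by (intro mult_right_mono) auto
    then show ?thesis by simp
  qed
  have cat: "\<bar>p\<bar> \<le> r" "\<bar>q\<bar> \<le> r" if "p\<^sup>2 + q\<^sup>2 = r\<^sup>2" "0 \<le> r" for p q r :: real
    by (rule power2_le_imp_le[OF _ that(2)]; simp flip: that(1))+
  have rad0: "0 \<le> real (Suc i) * \<xi> / 4" for i using \<xi>(1) by simp
  note s_hi = cat(1)[OF st rad0] and t_hi = cat(2)[OF st rad0]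
  have s\<xi>: "\<bar>s i\<bar> \<le> \<xi>" and t\<xi>: "\<bar>t i\<bar> \<le> \<xi>" if "i < 4" for i
    using order_trans[OF s_hi[OF that] rad[OF that]] order_trans[OF t_hi[OF that] rad[OF that]] by blast+
  note el = eliminate_transversal[OF M bnd \<mu> \<xi>(1,2) s\<xi> t\<xi> \<kappa>(1) \<kappa>\<xi> ev ee]
  have t16: "\<bar>t i\<bar> \<le> \<xi> / 16" if "i < 4" for i
  proof -
    have "M * \<xi> \<le> M^3 * \<xi>" "0 \<le> M^3 * \<xi>" using M3 M \<xi> by simp_all
    then have "64 * (M * \<xi>) \<le> 10^8 * (M^3 * \<xi>)" using M \<xi>(1) by (intro mult_mono) auto
    also have "\<dots> \<le> c0 * ?l" by (rule \<sigma>)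
    also have "\<dots> \<le> ?l" using c0 by (simp add: mult_left_le_one_le)
    finally have m: "64 * (M * \<xi>) \<le> ?l" .
    have "?l * \<bar>t i\<bar> \<le> 4 * M * \<xi>\<^sup>2" using el(1)[OF that that that that] .
    also have "\<dots> = (64 * (M * \<xi>)) * (\<xi> / 16)" by (simp add: power2_eq_square)
    also have "\<dots> \<le> ?l * (\<xi> / 16)" using m \<xi> by (intro mult_right_mono) auto
    finally show ?thesis using l mult_le_cancel_left_pos by blast
  qed
  \<comment> \<open>A leg of a right triangle is at least the hypotenuse minus the other
    leg.\<close>
  have cat_lo: "r - \<bar>q\<bar> \<le> \<bar>p\<bar>" if "p\<^sup>2 + q\<^sup>2 = r\<^sup>2" "\<bar>q\<bar> \<le> r" for p q r :: real
  proof -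
    have "0 \<le> \<bar>q\<bar> * (r - \<bar>q\<bar>)" using that(2) by simp
    moreover have "(r - \<bar>q\<bar>)\<^sup>2 = r\<^sup>2 - \<bar>q\<bar>\<^sup>2 - 2 * (\<bar>q\<bar> * (r - \<bar>q\<bar>))" by algebra
    moreover have "\<bar>p\<bar>\<^sup>2 + \<bar>q\<bar>\<^sup>2 = r\<^sup>2" using that(1) by simp
    ultimately have "(r - \<bar>q\<bar>)\<^sup>2 \<le> \<bar>p\<bar>\<^sup>2" by linarith
    then show ?thesis by (rule power2_le_imp_le) simp
  qed
  have s_lo: "real (Suc i) * \<xi> / 4 - \<xi> / 16 \<le> \<bar>s i\<bar>" if "i < 4" for i
    using cat_lo[OF st[OF that] t_hi[OF that]] t16[OF that] by linarith
  \<comment> \<open>In units of \<open>c0 / 10^8\<close>, the two terms with \<kappa> contribute 1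
    each and the remainder contributes 24. The factor \<open>8 * \<xi>\<^sup>2\<close> in the next
    bound arises because \<open>\<bar>s i\<bar>\<close> is at least \<xi> / 8; a zero cubic term is
    added to fit \<open>cubic_coefficient_bound\<close>.\<close>
  define \<omega> where "\<omega> = 26 * c0 / 10^8"
  have q: "\<bar>\<mu> * \<epsilon> + (\<mu> * a / 2) * s i + D * (s i)\<^sup>2 + 0 * (s i)^3\<bar> \<le> 8 * \<xi>\<^sup>2 * \<omega>" if "i < 4" for i
  proof -
    let ?q = "\<bar>\<mu> * \<epsilon> + (\<mu> * a / 2) * s i + D * (s i)\<^sup>2\<bar>"
    have eq: "\<mu> * \<epsilon> * s i + \<mu> * a / 2 * (s i)\<^sup>2 + D * (s i)^3 
        = s i * (\<mu> * \<epsilon> + (\<mu> * a / 2) * s i + D * (s i)\<^sup>2)"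
      by (simp add: power2_eq_square power3_eq_cube algebra_simps)
    have s8: "\<xi> / 8 \<le> \<bar>s i\<bar>"
    proof -
      have "1 * \<xi> \<le> real (Suc i) * \<xi>" using \<xi>(1) by (intro mult_right_mono) auto
      then show ?thesis using s_lo[OF that] \<xi>(1) by linarith
    qed
    have "?l * (\<xi> / 8 * ?q) \<le> ?l * (\<bar>s i\<bar> * ?q)"
      by (intro mult_left_mono mult_right_mono s8) auto
    also have "\<dots> \<le> \<mu>\<^sup>2 * \<kappa> + M * \<xi> * ?l * \<kappa> + 24 * M^3 * \<xi>^4"
      using el(2)[OF that that that that] unfolding D_def[symmetric] eq abs_mult .
    also have "\<dots> \<le> ?l * (M * \<kappa>) + ?l * (M * \<kappa>) + 24 * \<xi>^3 * (M^3 * \<xi>)"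
    proof -
      have "\<mu>\<^sup>2 * \<kappa> \<le> ?l * (M * \<kappa>)"
        using mult_left_mono[OF mult_right_mono[OF bnd(1) \<kappa>(1)], of ?l]
        by (simp add: power2_eq_square mult.assoc[symmetric])
      moreover have "M * \<xi> * ?l * \<kappa> \<le> ?l * (M * \<kappa>)"
        using mult_right_mono[OF \<xi>(2), of "M * ?l * \<kappa>"] M \<kappa>(1) by (simp add: algebra_simps)
      moreover have "24 * M^3 * \<xi>^4 = 24 * \<xi>^3 * (M^3 * \<xi>)" by (simp add: power3_eq_cube power4_eq_xxxx)
      ultimately show ?thesis by linarith
    qed
    also have "\<dots> \<le> ?l * (c0 * \<xi>^3 / 10^8) + ?l * (c0 * \<xi>^3 / 10^8) + 24 * \<xi>^3 * (c0 * ?l / 10^8)"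
      using \<sigma> \<kappa>' \<xi>(1) by (intro add_mono mult_left_mono) auto
    also have "\<dots> = ?l * (\<xi> / 8 * (8 * \<xi>\<^sup>2 * \<omega>))"
      by (simp add: \<omega>_def power2_eq_square power3_eq_cube)
    finally have "\<xi> / 8 * ?q \<le> \<xi> / 8 * (8 * \<xi>\<^sup>2 * \<omega>)" using l mult_le_cancel_left_pos by blast
    moreover have "0 < \<xi> / 8" using \<xi>(1) by simp
    ultimately have "?q \<le> 8 * \<xi>\<^sup>2 * \<omega>" using mult_le_cancel_left_pos by blast
    then show ?thesis by simp
  qed
  note cb = cubic_coefficient_bound[OF \<xi>(1) s_lo s_hi q]
  have \<omega>: "0 < \<omega>" using c0 by (simp add: \<omega>_def)
  have \<xi>2: "0 < \<xi>\<^sup>2" "\<xi>\<^sup>2 \<le> 1" using \<xi> by (simp_all add: power_le_one)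
  have "\<bar>\<mu> * \<epsilon>\<bar> \<le> 480000 * \<omega> * \<xi>\<^sup>2" using cb(1) by (simp add: mult_ac)
  also have "\<dots> \<le> 480000 * \<omega>" using \<omega> \<xi>2 by (intro mult_right_le_one_le) auto
  finally have 1: "\<bar>\<mu> * \<epsilon>\<bar> \<le> 480000 * \<omega>" .
  \<comment> \<open>The factor \<open>?l\<close> on the left cancels against the factor \<xi> on the
    right, since \<xi> is at most \<open>?l\<close>.\<close>
  have "?l * \<bar>a\<bar> \<le> 960000 * \<omega> * \<xi>"
    using cb(2) \<xi>(1) by (simp add: abs_mult power2_eq_square mult_ac)
  also have "\<dots> \<le> 960000 * \<omega> * ?l" using \<omega> \<xi>l by (intro mult_left_mono) auto
  finally have 2: "\<bar>a\<bar> \<le> 960000 * \<omega>" using l by (simp add: mult.commute)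
  have 3: "\<bar>D\<bar> \<le> 480000 * \<omega>" using cb(3) \<xi>2 by (simp add: mult_ac)
  \<comment> \<open>1920000 is the sum of the three factors; with \<open>10^8\<close> in the
    denominator the total stays just below half of \<open>c0\<close>.\<close>
  have "1920000 * \<omega> < c0" using c0 by (simp add: \<omega>_def)
  then show ?thesis using 1 2 3 by (simp add: D_def)
qed

section \<open>Lines\<close>

lemma diff_form_replicate_scale:
  "diff_form f x (us @ replicate k (t *\<^sub>R v) @ ws) = t ^ k * diff_form f x (us @ replicate k v @ ws)"
proof (induction k arbitrary: us)
  case 0
  then show ?case by simp
next
  case (Suc k)
  have "diff_form f x (us @ t *\<^sub>R v # replicate k (t *\<^sub>R v) @ ws)
      = t * diff_form f x ((us @ [v]) @ replicate k (t *\<^sub>R v) @ ws)"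
    using diff_form_slot_linear[of f x us t v 0 v "replicate k (t *\<^sub>R v) @ ws"] by simp
  also have "\<dots> = t * (t ^ k * diff_form f x ((us @ [v]) @ replicate k v @ ws))"
    by (simp only: Suc.IH)
  finally show ?case by simp
qed

text \<open>If every radius fails, four of them supply points \<open>t i\<close>, of unknown sign,
  with small derivative. Dividing the Taylor expansion by \<open>t i\<close> leaves a cubic
  polynomial whose coefficients are the forms of orders 2 to 5 up to factorials; all of these would
  be small, contrary to \<open>c0\<close>. The remainder involves five increments and one
  \<open>v\<close>, hence forms of length up to 6.\<close>

lemma line_estimate:
  fixes f :: "real^'n::finite \<Rightarrow> real"
  assumes f: "smooth_on A f" "open A" and S: "convex S" "S \<subseteq> A" "cball x \<xi> \<subseteq> S"
    and M: "1 \<le> M" "\<And>y vs. y \<in> S \<Longrightarrow> length vs \<le> 6 \<Longrightarrow> \<bar>diff_form f y vs\<bar> \<le> M * prod_list (map norm vs)"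
    and v: "norm v = 1" "diff_form f x [v] = 0"
    and c0: "0 < c0" "c0 \<le> (\<Sum>k=2..5. \<bar>diff_form f x (replicate k v)\<bar>)"
    and \<xi>: "0 < \<xi>" "\<xi> \<le> 1" "10^8 * (M * \<xi>) \<le> c0"
  shows "\<exists>\<eta>. 0 \<le> \<eta> \<and> \<eta> \<le> \<xi> \<and> (\<forall>t. \<bar>t\<bar> = \<eta> \<longrightarrow> c0 / 10^8 * \<xi>^4 \<le> \<bar>diff_form f (x + t *\<^sub>R v) [v]\<bar>)"
proof (rule ccontr)
  define c where "c = c0 / 10^8"
  assume contr: "\<not> ?thesis"
  have rad: "0 \<le> real (Suc i) * \<xi> / 4" "real (Suc i) * \<xi> / 4 \<le> \<xi>" if "i < 4" for i
  proof -
    have "real (Suc i) * \<xi> \<le> 4 * \<xi>" using that \<xi>(1) by (intro mult_right_mono) auto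
    then show "real (Suc i) * \<xi> / 4 \<le> \<xi>" by simp
  qed (use \<xi>(1) in simp)
  have "\<exists>t. \<bar>t\<bar> = real (Suc i) * \<xi> / 4 \<and> \<bar>diff_form f (x + t *\<^sub>R v) [v]\<bar> < c * \<xi>^4" if "i < 4" for i
    using contr rad[OF that] unfolding c_def by (meson not_le)
  then obtain t where t: "\<And>i. i < 4 \<Longrightarrow> \<bar>t i\<bar> = real (Suc i) * \<xi> / 4"
      "\<And>i. i < 4 \<Longrightarrow> \<bar>diff_form f (x + t i *\<^sub>R v) [v]\<bar> < c * \<xi>^4"
    by metis
  define a where "a = (\<lambda>k. diff_form f x (replicate k v))"
  have xS: "x \<in> S" using S(3) \<xi>(1) by auto
  \<comment> \<open>\<open>c\<close> stems from the assumed small derivative and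
    \<open>M * \<xi>\<close> from the Taylor remainder. Dividing by \<open>\<bar>t i\<bar>\<close>,
    at least \<xi> / 4, costs the factor 4 in 240000.\<close>
  define B where "B = 240000 * (c + M * \<xi>)"
  have q: "\<bar>a 2 + (a 3 / 2) * t i + (a 4 / 6) * (t i)\<^sup>2 + (a 5 / 24) * (t i)^3\<bar> \<le> \<xi>^3 * (B / 60000)"
    if "i < 4" for i
  proof -
    let ?q = "a 2 + (a 3 / 2) * t i + (a 4 / 6) * (t i)\<^sup>2 + (a 5 / 24) * (t i)^3"
    have ti: "\<bar>t i\<bar> \<le> \<xi>" "\<xi> / 4 \<le> \<bar>t i\<bar>" "x + t i *\<^sub>R v \<in> S"
    proof -
      show 1: "\<bar>t i\<bar> \<le> \<xi>" using rad(2)[OF that] t(1)[OF that] by simp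
      have "1 * \<xi> \<le> real (Suc i) * \<xi>" using \<xi>(1) by (intro mult_right_mono) auto
      then show "\<xi> / 4 \<le> \<bar>t i\<bar>" using t(1)[OF that] by simp
      show "x + t i *\<^sub>R v \<in> S" using S(3) 1 v(1) by (auto simp: dist_norm)
    qed
    have t5: "\<bar>t i\<bar>^5 \<le> \<xi>^5" using ti(1) by (intro power_mono) auto
    have "\<bar>diff_form f y (replicate 5 (t i *\<^sub>R v) @ [v])\<bar> \<le> M * \<xi>^5" if "y \<in> S" for y
    proof -
      have "\<bar>diff_form f y (replicate 5 (t i *\<^sub>R v) @ [v])\<bar> \<le> M * \<bar>t i\<bar>^5"
        using M(2)[OF that, of "replicate 5 (t i *\<^sub>R v) @ [v]"] v(1)
        by (simp add: eval_nat_numeral)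
      also have "\<dots> \<le> M * \<xi>^5" using t5 M(1) by simp
      finally show ?thesis .
    qed
    then have "\<bar>diff_form f (x + t i *\<^sub>R v) [v]
        - (\<Sum>k<5. diff_form f x (replicate k (t i *\<^sub>R v) @ [v]) / fact k)\<bar> \<le> M * \<xi>^5"
      using M(1) \<xi>(1) by (intro diff_form_taylor_bound[OF f S(1,2) xS ti(3)]) auto
    moreover have "(\<Sum>k<5. diff_form f x (replicate k (t i *\<^sub>R v) @ [v]) / fact k) = t i * ?q"
    proof -
      have "diff_form f x (replicate k (t i *\<^sub>R v) @ [v]) = t i ^ k * a (Suc k)" for k
        using diff_form_replicate_scale[of f x "[]" k "t i" v "[v]"]
        by (simp add: a_def replicate_append_same)
      moreover have "a (Suc 0) = 0" using v(2) by (simp add: a_def)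
      ultimately show ?thesis
        by (simp add: eval_nat_numeral field_simps)
    qed
    ultimately have "\<bar>t i * ?q\<bar> \<le> c * \<xi>^4 + M * \<xi>^5" using t(2)[OF that] by linarith
    then have "\<xi> / 4 * \<bar>?q\<bar> \<le> c * \<xi>^4 + M * \<xi>^5"
      using mult_right_mono[OF ti(2), of "\<bar>?q\<bar>"] by (simp add: abs_mult)
    also have "\<dots> = \<xi> / 4 * (\<xi>^3 * (B / 60000))"
      by (simp add: B_def eval_nat_numeral field_simps)
    finally show ?thesis by (rule mult_left_le_imp_le) (use \<xi>(1) in simp)
  qed
  have t1: "real (Suc i) * \<xi> / 4 - \<xi> / 16 \<le> \<bar>t i\<bar>" "\<bar>t i\<bar> \<le> real (Suc i) * \<xi> / 4" if "i < 4" for i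
    using t(1)[OF that] \<xi>(1) by simp_all
  note cb = cubic_coefficient_bound[OF \<xi>(1) t1 q]
  have B: "0 \<le> B" using c0 M(1) \<xi>(1) by (simp add: B_def c_def)
  have pw: "\<xi>^3 \<le> 1" "\<xi>\<^sup>2 \<le> 1" using \<xi> by (simp_all add: power_le_one)
  have "\<bar>a 2\<bar> \<le> B * \<xi>^3" using cb(1) by (simp add: mult_ac)
  also have "\<dots> \<le> B" using B pw \<xi>(1) by (intro mult_right_le_one_le) auto
  finally have a2: "\<bar>a 2\<bar> \<le> B" .
  have "\<xi> * \<bar>a 3\<bar> \<le> \<xi> * (2 * B * \<xi>\<^sup>2)" using cb(2) by (simp add: eval_nat_numeral mult_ac)
  then have "\<bar>a 3\<bar> \<le> 2 * B * \<xi>\<^sup>2" using \<xi>(1) by simp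
  also have "\<dots> \<le> 2 * B" using B pw \<xi>(1) by (intro mult_right_le_one_le) auto
  finally have a3: "\<bar>a 3\<bar> \<le> 2 * B" .
  have "\<xi>\<^sup>2 * \<bar>a 4\<bar> \<le> \<xi>\<^sup>2 * (6 * B * \<xi>)" using cb(3) by (simp add: eval_nat_numeral mult_ac)
  then have "\<bar>a 4\<bar> \<le> 6 * B * \<xi>" using \<xi>(1) by simp
  also have "\<dots> \<le> 6 * B" using B \<xi> by (intro mult_right_le_one_le) auto
  finally have a4: "\<bar>a 4\<bar> \<le> 6 * B" .
  have "\<xi>^3 * \<bar>a 5\<bar> \<le> \<xi>^3 * (24 * B)" using cb(4) by (simp add: mult_ac)
  then have a5: "\<bar>a 5\<bar> \<le> 24 * B" using \<xi>(1) by simp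
  have "(\<Sum>k=2..5. \<bar>a k\<bar>) = \<bar>a 2\<bar> + \<bar>a 3\<bar> + \<bar>a 4\<bar> + \<bar>a 5\<bar>" by (simp add: eval_nat_numeral)
  \<comment> \<open>33 is 1 + 2 + 6 + 24, the sum of the denominators of the four
    coefficients.\<close>
  then have "c0 \<le> 33 * B" using c0(2) a2 a3 a4 a5 by (simp add: a_def)
  also have "\<dots> \<le> 33 * (240000 * (c0 / 10^8 + c0 / 10^8))"
    using \<xi>(3) by (simp add: B_def c_def)
  also have "\<dots> < c0" using c0(1) by simp
  finally show False by simp
qed

section \<open>Planes\<close>

lemma diff_form_expand1: "diff_form f x [s *\<^sub>R v + t *\<^sub>R e] = s * diff_form f x [v] + t * diff_form f x [e]"
  using diff_form_slot_linear[of f x "[]" s v t e "[]"] by simp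

lemma diff_form_expand2:
  "diff_form f x [s *\<^sub>R v + t *\<^sub>R e, u] = s * diff_form f x [v, u] + t * diff_form f x [e, u]"
  "diff_form f x [u, s *\<^sub>R v + t *\<^sub>R e] = s * diff_form f x [u, v] + t * diff_form f x [u, e]"
  using diff_form_slot_linear[of f x "[]" s v t e "[u]"] diff_form_slot_linear[of f x "[u]" s v t e "[]"] by simp_all

lemma diff_form_expand3:
  "diff_form f x [s *\<^sub>R v + t *\<^sub>R e, s *\<^sub>R v + t *\<^sub>R e, u]
     = s\<^sup>2 * diff_form f x [v, v, u] + (s * t) * (diff_form f x [v, e, u] + diff_form f x [e, v, u])
       + t\<^sup>2 * diff_form f x [e, e, u]"
proof -
  have 1: "diff_form f x [w, s *\<^sub>R v + t *\<^sub>R e, u] = s * diff_form f x [w, v, u] + t * diff_form f x [w, e, u]" for w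
    using diff_form_slot_linear[of f x "[w]" s v t e "[u]"] by simp
  have 2: "diff_form f x [s *\<^sub>R v + t *\<^sub>R e, w, u] = s * diff_form f x [v, w, u] + t * diff_form f x [e, w, u]" for w
    using diff_form_slot_linear[of f x "[]" s v t e "[w, u]"] by simp
  show ?thesis unfolding 2 unfolding 1 by (simp add: algebra_simps power2_eq_square)
qed

lemma norm_orthonormal_combination:
  fixes v e :: "'a::real_inner"
  assumes "norm v = 1" "norm e = 1" "v \<bullet> e = 0"
  shows "(norm (s *\<^sub>R v + t *\<^sub>R e))\<^sup>2 = s\<^sup>2 + t\<^sup>2"
    and "(s *\<^sub>R v + t *\<^sub>R e) \<bullet> ((-t) *\<^sub>R v + s *\<^sub>R e) = 0"
proof -
  have "v \<bullet> v = 1" "e \<bullet> e = 1" "e \<bullet> v = 0"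
    using assms by (simp_all add: norm_eq_1 inner_commute)
  then show "(norm (s *\<^sub>R v + t *\<^sub>R e))\<^sup>2 = s\<^sup>2 + t\<^sup>2" "(s *\<^sub>R v + t *\<^sub>R e) \<bullet> ((-t) *\<^sub>R v + s *\<^sub>R e) = 0"
    using assms(3)
    by (simp_all only: power2_norm_eq_inner inner_add_left inner_add_right inner_scaleR_left inner_scaleR_right)
      (simp_all add: power2_eq_square)
qed

text \<open>Data at a point of a plane orthogonal to the gradient, in a basis diagonalizing the Hessian.\<close>

locale plane_data =
  fixes f :: "real^'n::finite \<Rightarrow> real" and A S :: "(real^'n) set" and x v e :: "real^'n" and M c0 :: real
  assumes f: "smooth_on A f" "open A" and S: "convex S" "S \<subseteq> A" "x \<in> S"
    and M: "1 \<le> M" "\<And>y vs. y \<in> S \<Longrightarrow> length vs \<le> 6 \<Longrightarrow> \<bar>diff_form f y vs\<bar> \<le> M * prod_list (map norm vs)"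
    and ve: "norm v = 1" "norm e = 1" "v \<bullet> e = 0"
    and crit: "diff_form f x [v] = 0" "diff_form f x [e] = 0"
    and diag: "diff_form f x [v, e] = 0" "\<bar>diff_form f x [v, v]\<bar> \<le> \<bar>diff_form f x [e, e]\<bar>"
    and c0: "0 < c0" "c0 \<le> 1"
    and quartic: "c0 \<le> \<bar>diff_form f x [e, e] * diff_form f x [v, v]\<bar> + \<bar>diff_form f x [v, v, v]\<bar>
      + \<bar>diff_form f x [e, e] * diff_form f x [v, v, v, v] / 6 - (diff_form f x [v, v, e])\<^sup>2 / 2\<bar>"
    and cubic: "\<And>w w'. \<lbrakk>norm w = 1; norm w' = 1; w \<bullet> w' = 0; diff_form f x [w] = 0; diff_form f x [w'] = 0\<rbrakk> \<Longrightarrow>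
      c0 \<le> \<bar>diff_form f x [w, w]\<bar> + \<bar>diff_form f x [w, w']\<bar> + \<bar>diff_form f x [w', w']\<bar>
        + \<bar>diff_form f x [w, w, w]\<bar> + \<bar>diff_form f x [w, w, w']\<bar>"
begin

section \<open>Expansions of the derivatives along the two axes\<close>

abbreviation "\<mu> \<equiv> diff_form f x [e, e]"

text \<open>A third-order remainder suffices for the derivative along \<open>e\<close>, from which
  only the leading behaviour of \<open>t\<close> is extracted, and where the cubic part of
  \<open>f\<close> dominates. The derivative along \<open>v\<close> needs one order more.\<close>

lemma taylor2:
  assumes "x + z \<in> S" "norm u = 1" "diff_form f x [u] = 0"
  shows "\<bar>diff_form f (x + z) [u] - (diff_form f x [z, u] + diff_form f x [z, z, u] / 2)\<bar> \<le> M * norm z ^ 3"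
proof -
  have "\<bar>diff_form f y (replicate 3 z @ [u])\<bar> \<le> M * norm z ^ 3" if "y \<in> S" for y
    using M(2)[OF that, of "replicate 3 z @ [u]"] assms(2) by (simp add: eval_nat_numeral mult_ac)
  then have "\<bar>diff_form f (x + z) [u] - (\<Sum>k<3. diff_form f x (replicate k z @ [u]) / fact k)\<bar> \<le> M * norm z ^ 3"
    using M(1) by (intro diff_form_taylor_bound[OF f S assms(1)]) auto
  then show ?thesis using assms(3) by (simp add: eval_nat_numeral)
qed

lemma taylor3:
  assumes "x + z \<in> S" "norm u = 1" "diff_form f x [u] = 0"
  shows "\<bar>diff_form f (x + z) [u] - (diff_form f x [z, u] + diff_form f x [z, z, u] / 2
      + diff_form f x [z, z, z, u] / 6)\<bar> \<le> M * norm z ^ 4"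
proof -
  have "\<bar>diff_form f y (replicate 4 z @ [u])\<bar> \<le> M * norm z ^ 4" if "y \<in> S" for y
    using M(2)[OF that, of "replicate 4 z @ [u]"] assms(2) by (simp add: eval_nat_numeral mult_ac)
  then have "\<bar>diff_form f (x + z) [u] - (\<Sum>k<4. diff_form f x (replicate k z @ [u]) / fact k)\<bar> \<le> M * norm z ^ 4"
    using M(1) by (intro diff_form_taylor_bound[OF f S assms(1)]) auto
  then show ?thesis using assms(3) by (simp add: eval_nat_numeral add.assoc)
qed

lemma coefficient_bound:
  assumes "set us \<subseteq> {v, e}" "length us \<le> 6"
  shows "\<bar>diff_form f x us\<bar> \<le> M"
proof -
  have "prod_list (map norm us) = 1" using assms(1) ve by (induction us) auto
  then show ?thesis using M(2)[OF S(3) assms(2)] by simp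
qed

text \<open>Supplies the hypothesis \<open>ee\<close> of \<open>eliminate_transversal\<close>. There
  is no term linear in \<open>s\<close> because the Hessian is diagonal. The coefficients of the
  mixed term are left unsimplified, as only their size will matter.\<close>

lemma transversal_derivative:
  assumes st: "s\<^sup>2 + t\<^sup>2 \<le> \<xi>\<^sup>2" "0 \<le> \<xi>" and inS: "x + (s *\<^sub>R v + t *\<^sub>R e) \<in> S"
    and small: "\<bar>diff_form f (x + (s *\<^sub>R v + t *\<^sub>R e)) [e]\<bar> \<le> \<kappa>"
  shows "\<bar>\<mu> * t + (diff_form f x [v, v, e] * s\<^sup>2 + (diff_form f x [v, e, e] + diff_form f x [e, v, e]) * s * t
      + diff_form f x [e, e, e] * t\<^sup>2) / 2\<bar> \<le> \<kappa> + M * \<xi>^3"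
proof -
  let ?z = "s *\<^sub>R v + t *\<^sub>R e"
  have "norm ?z \<le> \<xi>" by (rule power2_le_imp_le) (use st norm_orthonormal_combination(1)[OF ve] in auto)
  then have "M * norm ?z ^ 3 \<le> M * \<xi>^3" using M(1) by (intro mult_left_mono power_mono) auto
  moreover have "diff_form f x [?z, e] + diff_form f x [?z, ?z, e] / 2 =
    \<mu> * t + (diff_form f x [v, v, e] * s\<^sup>2 + (diff_form f x [v, e, e] + diff_form f x [e, v, e]) * s * t
      + diff_form f x [e, e, e] * t\<^sup>2) / 2"
    unfolding diff_form_expand3 diff_form_expand2 using diag(1) by (simp add: algebra_simps)
  ultimately show ?thesis using taylor2[OF inS ve(2) crit(2)] small by linarith
qed

text \<open>Supplies the hypothesis \<open>ev\<close> of \<open>eliminate_transversal\<close>. Of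
  the terms of third degree only the pure power of \<open>s\<close> is kept; all others contain a
  factor \<open>t\<close> and go into the error.\<close>

lemma tangential_derivative:
  assumes st: "s\<^sup>2 + t\<^sup>2 \<le> \<xi>\<^sup>2" "0 \<le> \<xi>" and inS: "x + (s *\<^sub>R v + t *\<^sub>R e) \<in> S"
    and small: "\<bar>diff_form f (x + (s *\<^sub>R v + t *\<^sub>R e)) [v]\<bar> \<le> \<kappa>"
  shows "\<bar>diff_form f x [v, v] * s + (diff_form f x [v, v, v] * s\<^sup>2 + 2 * diff_form f x [v, v, e] * s * t
      + diff_form f x [e, e, v] * t\<^sup>2) / 2 + diff_form f x [v, v, v, v] * s^3 / 6\<bar>
    \<le> \<kappa> + M * (\<bar>t\<bar> * \<xi>\<^sup>2 + \<xi>^4)"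
proof -
  let ?z = "s *\<^sub>R v + t *\<^sub>R e"
  have z: "norm ?z \<le> \<xi>" by (rule power2_le_imp_le) (use st norm_orthonormal_combination(1)[OF ve] in auto)
  have s: "\<bar>s\<bar> \<le> \<xi>"
  proof (rule power2_le_imp_le)
    have "0 \<le> t\<^sup>2" by simp
    then show "\<bar>s\<bar>\<^sup>2 \<le> \<xi>\<^sup>2" using st(1) unfolding power2_abs by linarith
  qed (rule st(2))
  have "M * norm ?z ^ 4 \<le> M * \<xi>^4" using M(1) z by (intro mult_left_mono power_mono) auto
  note R = order_trans[OF taylor3[OF inS ve(1) crit(1)] this]
  have xA: "x \<in> A" using S by blast
  \<comment> \<open>Symmetry is essential here: the mixed coefficient must be the same
    \<open>diff_form f x [v, v, e]\<close> that multiplies \<open>s\<^sup>2\<close> in the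
    transversal derivative, so that the elimination produces its square.\<close>
  have sym: "diff_form f x [e, v] = 0" "diff_form f x [v, e, v] = diff_form f x [v, v, e]"
    "diff_form f x [e, v, v] = diff_form f x [v, v, e]"
    using diff_form_swap[OF f xA, of "[]" e v "[]"] diff_form_swap[OF f xA, of "[v]" e v "[]"]
      diff_form_swap[OF f xA, of "[]" e v "[v]"] diag(1) by simp_all
  have low: "diff_form f x [?z, v] + diff_form f x [?z, ?z, v] / 2
    = diff_form f x [v, v] * s + (diff_form f x [v, v, v] * s\<^sup>2 + 2 * diff_form f x [v, v, e] * s * t
      + diff_form f x [e, e, v] * t\<^sup>2) / 2"
    unfolding diff_form_expand3 diff_form_expand2 using sym by (simp add: algebra_simps)
  \<comment> \<open>Replacing \<open>?z\<close> by \<open>s *\<^sub>R v\<close> in one slot after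
    another leaves an error \<open>t * E\<close>.\<close>
  define E where "E = diff_form f x [e, ?z, ?z, v] + s * diff_form f x [v, e, ?z, v] + s\<^sup>2 * diff_form f x [v, v, e, v]"
  have high: "diff_form f x [?z, ?z, ?z, v] = s^3 * diff_form f x [v, v, v, v] + t * E"
    using diff_form_slot_linear[of f x "[]" s v t e "[?z, ?z, v]"] diff_form_slot_linear[of f x "[v]" s v t e "[?z, v]"]
      diff_form_slot_linear[of f x "[v, v]" s v t e "[v]"]
    by (simp add: E_def algebra_simps power2_eq_square power3_eq_cube)
  have "\<bar>E\<bar> \<le> 3 * (M * \<xi>\<^sup>2)"
  proof -
    have zz: "norm ?z * norm ?z \<le> \<xi>\<^sup>2" "\<bar>s\<bar> * norm ?z \<le> \<xi>\<^sup>2" "\<bar>s\<bar> * \<bar>s\<bar> \<le> \<xi>\<^sup>2"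
      unfolding power2_eq_square by (intro mult_mono z s; simp add: st(2))+
    have "\<bar>diff_form f x [e, ?z, ?z, v]\<bar> \<le> M * (norm ?z * norm ?z)"
      using M(2)[OF S(3), of "[e, ?z, ?z, v]"] ve by simp
    also have "\<dots> \<le> M * \<xi>\<^sup>2" using zz M(1) by (intro mult_left_mono) auto
    finally have 1: "\<bar>diff_form f x [e, ?z, ?z, v]\<bar> \<le> M * \<xi>\<^sup>2" .
    have "\<bar>s * diff_form f x [v, e, ?z, v]\<bar> \<le> \<bar>s\<bar> * (M * norm ?z)"
      unfolding abs_mult using M(2)[OF S(3), of "[v, e, ?z, v]"] ve by (intro mult_left_mono) auto
    also have "\<dots> = M * (\<bar>s\<bar> * norm ?z)" by simp
    also have "\<dots> \<le> M * \<xi>\<^sup>2" using zz M(1) by (intro mult_left_mono) auto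
    finally have 2: "\<bar>s * diff_form f x [v, e, ?z, v]\<bar> \<le> M * \<xi>\<^sup>2" .
    have "\<bar>s\<^sup>2 * diff_form f x [v, v, e, v]\<bar> \<le> (\<bar>s\<bar> * \<bar>s\<bar>) * M"
      unfolding abs_mult power2_eq_square using coefficient_bound[of "[v, v, e, v]"] by (intro mult_left_mono) auto
    also have "\<dots> \<le> \<xi>\<^sup>2 * M" using zz M(1) by (intro mult_right_mono) auto
    finally have 3: "\<bar>s\<^sup>2 * diff_form f x [v, v, e, v]\<bar> \<le> M * \<xi>\<^sup>2" by (simp add: mult.commute)
    show ?thesis unfolding E_def using 1 2 3 by linarith
  qed
  then have "\<bar>t * E\<bar> \<le> \<bar>t\<bar> * (3 * (M * \<xi>\<^sup>2))" unfolding abs_mult by (intro mult_left_mono) auto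
  moreover have "0 \<le> M * (\<bar>t\<bar> * \<xi>\<^sup>2)" using M(1) by simp
  moreover have "\<bar>t\<bar> * (3 * (M * \<xi>\<^sup>2)) = 3 * (M * (\<bar>t\<bar> * \<xi>\<^sup>2))" by simp
  moreover have "\<bar>t * E / 6\<bar> = \<bar>t * E\<bar> / 6" by simp
  ultimately have tE: "\<bar>t * E / 6\<bar> \<le> M * (\<bar>t\<bar> * \<xi>\<^sup>2)" by linarith
  define P where "P = diff_form f x [v, v] * s + (diff_form f x [v, v, v] * s\<^sup>2 + 2 * diff_form f x [v, v, e] * s * t
      + diff_form f x [e, e, v] * t\<^sup>2) / 2 + diff_form f x [v, v, v, v] * s^3 / 6"
  have "diff_form f x [?z, v] + diff_form f x [?z, ?z, v] / 2 + diff_form f x [?z, ?z, ?z, v] / 6 = P + t * E / 6"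
    unfolding low high P_def by (simp add: algebra_simps add_divide_distrib)
  then have "\<bar>diff_form f (x + ?z) [v] - (P + t * E / 6)\<bar> \<le> M * \<xi>^4" using R by simp
  moreover have "\<bar>p\<bar> \<le> k + (g + m)" if "\<bar>h - (p + q)\<bar> \<le> m" "\<bar>h\<bar> \<le> k" "\<bar>q\<bar> \<le> g" for h p q k g m :: real
    using that by linarith
  ultimately have "\<bar>P\<bar> \<le> \<kappa> + (M * (\<bar>t\<bar> * \<xi>\<^sup>2) + M * \<xi>^4)" using small tE by blast
  then show ?thesis unfolding P_def by (simp add: distrib_left)
qed

text \<open>The Hessian dominates: its larger eigenvalue is at least of the order of the radius.\<close>

lemma near_estimate:
  assumes \<xi>: "0 < \<xi>" "\<xi> \<le> 1" "\<xi> \<le> c0 / (10^8 * M^3) * \<bar>\<mu>\<bar>" and ball: "cball x \<xi> \<subseteq> S"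
  shows "\<exists>\<eta>. 0 \<le> \<eta> \<and> \<eta> \<le> \<xi> \<and> (\<forall>s t. s\<^sup>2 + t\<^sup>2 = \<eta>\<^sup>2 \<longrightarrow>
    c0 / (10^8 * M) * \<xi>^3 \<le> \<bar>diff_form f (x + (s *\<^sub>R v + t *\<^sub>R e)) [v]\<bar> \<or>
    c0 / (10^8 * M) * \<xi>^3 \<le> \<bar>diff_form f (x + (s *\<^sub>R v + t *\<^sub>R e)) [e]\<bar>)"
proof (rule ccontr)
  define \<kappa> where "\<kappa> = c0 / (10^8 * M) * \<xi>^3"
  assume contr: "\<not> ?thesis"
  have rad: "0 \<le> real (Suc i) * \<xi> / 4" "real (Suc i) * \<xi> / 4 \<le> \<xi>" if "i < 4" for i
  proof -
    have "real (Suc i) * \<xi> \<le> 4 * \<xi>" using that \<xi>(1) by (intro mult_right_mono) auto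
    then show "real (Suc i) * \<xi> / 4 \<le> \<xi>" by simp
  qed (use \<xi>(1) in simp)
  \<comment> \<open>Failure at a radius yields a point on that circle where both derivatives are
    small. Four such points contradict \<open>quartic\<close>.\<close>
  have "\<exists>s t. s\<^sup>2 + t\<^sup>2 = (real (Suc i) * \<xi> / 4)\<^sup>2 \<and>
      \<bar>diff_form f (x + (s *\<^sub>R v + t *\<^sub>R e)) [v]\<bar> \<le> \<kappa> \<and> \<bar>diff_form f (x + (s *\<^sub>R v + t *\<^sub>R e)) [e]\<bar> \<le> \<kappa>" if "i < 4" for i
    using contr rad[OF that] unfolding \<kappa>_def by (meson linear)
  then obtain s t where st: "\<And>i. i < 4 \<Longrightarrow> (s i)\<^sup>2 + (t i)\<^sup>2 = (real (Suc i) * \<xi> / 4)\<^sup>2"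
    and dv: "\<And>i. i < 4 \<Longrightarrow> \<bar>diff_form f (x + (s i *\<^sub>R v + t i *\<^sub>R e)) [v]\<bar> \<le> \<kappa>"
    and de: "\<And>i. i < 4 \<Longrightarrow> \<bar>diff_form f (x + (s i *\<^sub>R v + t i *\<^sub>R e)) [e]\<bar> \<le> \<kappa>"
    by metis
  have st\<xi>: "(s i)\<^sup>2 + (t i)\<^sup>2 \<le> \<xi>\<^sup>2" if "i < 4" for i
    unfolding st[OF that] using rad[OF that] by (intro power_mono) auto
  have inS: "x + (s i *\<^sub>R v + t i *\<^sub>R e) \<in> S" if "i < 4" for i
  proof -
    have "norm (s i *\<^sub>R v + t i *\<^sub>R e) \<le> \<xi>"
      by (rule power2_le_imp_le) (use st\<xi>[OF that] norm_orthonormal_combination(1)[OF ve] \<xi>(1) in auto)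
    then have "x + (s i *\<^sub>R v + t i *\<^sub>R e) \<in> cball x \<xi>"
      using mem_cball[of "x + _"] by (metis add_diff_cancel_left' dist_commute dist_norm mem_cball)
    then show ?thesis using ball by blast
  qed
  have \<kappa>: "0 \<le> \<kappa>" "\<kappa> \<le> c0 / (10^8 * M) * \<xi>^3" using c0 M(1) \<xi>(1) by (simp_all add: \<kappa>_def)
  have "\<bar>diff_form f x [v, e, e] + diff_form f x [e, v, e]\<bar> \<le> 2 * M"
    using coefficient_bound[of "[v, e, e]"] coefficient_bound[of "[e, v, e]"] by simp
  then have "\<bar>\<mu> * diff_form f x [v, v]\<bar> + \<bar>diff_form f x [v, v, v]\<bar>
      + \<bar>\<mu> * diff_form f x [v, v, v, v] / 6 - (diff_form f x [v, v, e])\<^sup>2 / 2\<bar> < c0"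
    using coefficient_bound \<xi>(1)
    by (intro critical_points_at_four_radii[OF M(1) _ _ _ _ _ c0 \<xi> \<kappa> st
        tangential_derivative[OF st\<xi> _ inS dv] transversal_derivative[OF st\<xi> _ inS de]]) auto
  then show False using quartic by linarith
qed

text \<open>The cubic part dominates: the Hessian is small compared with the radius.\<close>

lemma far_estimate:
  assumes \<xi>: "0 < \<xi>" "32 * (M * \<xi>) \<le> c0" "\<bar>\<mu>\<bar> \<le> c0 / 64 * \<xi>" "\<xi> \<le> 1" and ball: "cball x \<xi> \<subseteq> S"
    and st: "s\<^sup>2 + t\<^sup>2 = \<xi>\<^sup>2"
  shows "\<exists>\<alpha> \<beta>. norm (\<alpha> *\<^sub>R v + \<beta> *\<^sub>R e) = 1 \<and>
    c0 / 16 * \<xi>\<^sup>2 \<le> \<bar>diff_form f (x + (s *\<^sub>R v + t *\<^sub>R e)) [\<alpha> *\<^sub>R v + \<beta> *\<^sub>R e]\<bar>"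
proof -
  \<comment> \<open>\<open>w\<close> is the unit vector towards the given point and
    \<open>w'\<close> its quarter turn; the radial or the angular derivative will be large.\<close>
  define \<alpha> \<beta> where "\<alpha> = s / \<xi>" and "\<beta> = t / \<xi>"
  define w where "w = \<alpha> *\<^sub>R v + \<beta> *\<^sub>R e"
  define w' where "w' = (-\<beta>) *\<^sub>R v + \<alpha> *\<^sub>R e"
  have \<alpha>\<beta>: "\<alpha>\<^sup>2 + \<beta>\<^sup>2 = 1" using st \<xi>(1) by (simp add: \<alpha>_def \<beta>_def power_divide flip: add_divide_distrib)
  have z: "s *\<^sub>R v + t *\<^sub>R e = \<xi> *\<^sub>R w" using \<xi>(1) by (simp add: w_def \<alpha>_def \<beta>_def scaleR_add_right)
  have nw: "norm w = 1" "norm w' = 1" "w \<bullet> w' = 0"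
    using norm_orthonormal_combination[OF ve, of \<alpha> \<beta>] norm_orthonormal_combination(1)[OF ve, of "-\<beta>" \<alpha>] \<alpha>\<beta>
    by (simp_all add: w_def w'_def add.commute power2_eq_1_iff)
      (smt (verit) norm_ge_zero)+
  have cw: "diff_form f x [w] = 0" "diff_form f x [w'] = 0"
    unfolding w_def w'_def diff_form_expand1 using crit by simp_all
  have xA: "x \<in> A" using S by blast
  have sym: "diff_form f x [e, v] = 0" using diff_form_swap[OF f xA, of "[]" e v "[]"] diag(1) by simp
  have ab1: "\<bar>\<alpha>\<bar> \<le> 1" "\<bar>\<beta>\<bar> \<le> 1"
    using \<alpha>\<beta> by (simp_all add: abs_square_le_1[symmetric]) (smt (verit) zero_le_power2)+
  have hess: "\<bar>p * diff_form f x [v, v] + q * \<mu>\<bar> \<le> 2 * \<bar>\<mu>\<bar>" if "\<bar>p\<bar> \<le> 1" "\<bar>q\<bar> \<le> 1" for p q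
  proof -
    have "\<bar>p * diff_form f x [v, v]\<bar> \<le> 1 * \<bar>\<mu>\<bar>" "\<bar>q * \<mu>\<bar> \<le> 1 * \<bar>\<mu>\<bar>"
      unfolding abs_mult by (intro mult_mono that diag(2) order_refl; simp)+
    then show ?thesis by linarith
  qed
  have pr: "\<bar>\<alpha> * \<alpha>\<bar> \<le> 1" "\<bar>\<beta> * \<beta>\<bar> \<le> 1" "\<bar>\<alpha> * \<beta>\<bar> \<le> 1" "\<bar>\<beta> * \<alpha>\<bar> \<le> 1"
    using ab1 unfolding abs_mult by (intro mult_le_one; simp)+
  have "diff_form f x [w, w] = (\<alpha> * \<alpha>) * diff_form f x [v, v] + (\<beta> * \<beta>) * \<mu>"
    "diff_form f x [w, w'] = (- (\<alpha> * \<beta>)) * diff_form f x [v, v] + (\<beta> * \<alpha>) * \<mu>"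
    "diff_form f x [w', w'] = (\<beta> * \<beta>) * diff_form f x [v, v] + (\<alpha> * \<alpha>) * \<mu>"
    unfolding w_def w'_def diff_form_expand2 using sym diag(1) by (simp_all add: algebra_simps)
  then have H: "\<bar>diff_form f x [w, w]\<bar> \<le> 2 * \<bar>\<mu>\<bar>" "\<bar>diff_form f x [w, w']\<bar> \<le> 2 * \<bar>\<mu>\<bar>" "\<bar>diff_form f x [w', w']\<bar> \<le> 2 * \<bar>\<mu>\<bar>"
    using hess[of "\<alpha> * \<alpha>" "\<beta> * \<beta>"] hess[of "- (\<alpha> * \<beta>)" "\<beta> * \<alpha>"] hess[of "\<beta> * \<beta>" "\<alpha> * \<alpha>"] pr by simp_all
  have "c0 / 64 * \<xi> \<le> c0 / 64" using c0 \<xi> by (intro mult_right_le_one_le) auto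
  then have \<mu>64: "\<bar>\<mu>\<bar> \<le> c0 / 64" using \<xi>(3) by linarith
  \<comment> \<open>The three Hessian entries together take at most \<open>6 * (c0 / 64)\<close>
    from \<open>cubic\<close>.\<close>
  have "c0 / 2 \<le> \<bar>diff_form f x [w, w, w]\<bar> + \<bar>diff_form f x [w, w, w']\<bar>"
    using cubic[OF nw cw] H \<mu>64 c0 by argo
  then have "c0 / 4 \<le> \<bar>diff_form f x [w, w, w]\<bar> \<or> c0 / 4 \<le> \<bar>diff_form f x [w, w, w']\<bar>" by linarith
  then obtain u where u: "u = w \<or> u = w'" "c0 / 4 \<le> \<bar>diff_form f x [w, w, u]\<bar>" by blast
  have nu: "norm u = 1" "diff_form f x [u] = 0" "\<bar>diff_form f x [w, u]\<bar> \<le> 2 * \<bar>\<mu>\<bar>"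
    using u(1) nw cw H by auto
  have inS: "x + \<xi> *\<^sub>R w \<in> S" using ball nw(1) \<xi>(1) by (auto simp: dist_norm)
  have sc: "diff_form f x [\<xi> *\<^sub>R w, u] = \<xi> * diff_form f x [w, u]"
    "diff_form f x [\<xi> *\<^sub>R w, \<xi> *\<^sub>R w, u] = \<xi>\<^sup>2 * diff_form f x [w, w, u]"
    using diff_form_replicate_scale[of f x "[]" 1 \<xi> w "[u]"] diff_form_replicate_scale[of f x "[]" 2 \<xi> w "[u]"]
    by (simp_all add: eval_nat_numeral)
  have T: "\<bar>diff_form f (x + \<xi> *\<^sub>R w) [u] - (\<xi> * diff_form f x [w, u] + \<xi>\<^sup>2 * diff_form f x [w, w, u] / 2)\<bar> \<le> M * \<xi>^3"
    using taylor2[OF inS nu(1,2)] nw(1) \<xi>(1) unfolding sc by simp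
  have c1: "\<bar>\<xi> * diff_form f x [w, u]\<bar> \<le> c0 / 32 * \<xi>\<^sup>2"
  proof -
    have "\<bar>diff_form f x [w, u]\<bar> \<le> 2 * (c0 / 64 * \<xi>)" using nu(3) \<xi>(3) by linarith
    then have "\<xi> * \<bar>diff_form f x [w, u]\<bar> \<le> \<xi> * (2 * (c0 / 64 * \<xi>))"
      using \<xi>(1) by (intro mult_left_mono) auto
    moreover have "\<bar>\<xi> * diff_form f x [w, u]\<bar> = \<xi> * \<bar>diff_form f x [w, u]\<bar>"
      using \<xi>(1) by (simp add: abs_mult)
    moreover have "\<xi> * (2 * (c0 / 64 * \<xi>)) = c0 / 32 * \<xi>\<^sup>2" by (simp add: power2_eq_square)
    ultimately show ?thesis by linarith
  qed
  have c2: "c0 / 8 * \<xi>\<^sup>2 \<le> \<bar>\<xi>\<^sup>2 * diff_form f x [w, w, u] / 2\<bar>"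
  proof -
    have "\<xi>\<^sup>2 * (c0 / 4) \<le> \<xi>\<^sup>2 * \<bar>diff_form f x [w, w, u]\<bar>" using u(2) by (intro mult_left_mono) auto
    then show ?thesis by (simp add: abs_mult mult.commute)
  qed
  have c3: "M * \<xi>^3 \<le> c0 / 32 * \<xi>\<^sup>2"
  proof -
    have "(M * \<xi>) * \<xi>\<^sup>2 \<le> (c0 / 32) * \<xi>\<^sup>2" using \<xi>(2) by (intro mult_right_mono) auto
    then show ?thesis by (simp add: eval_nat_numeral mult_ac)
  qed
  \<comment> \<open>The cubic part contributes 1/8, the Hessian and the remainder take at most 1/32
    each, and 1/16 is left.\<close>
  have tri: "c / 16 * k \<le> \<bar>h\<bar>" if "\<bar>h - (p + q)\<bar> \<le> m" "\<bar>p\<bar> \<le> c / 32 * k" "c / 8 * k \<le> \<bar>q\<bar>" "m \<le> c / 32 * k"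
    for h p q m c k :: real
    using that by linarith
  have "c0 / 16 * \<xi>\<^sup>2 \<le> \<bar>diff_form f (x + \<xi> *\<^sub>R w) [u]\<bar>" by (rule tri[OF T c1 c2 c3])
  moreover have "\<exists>\<alpha> \<beta>. u = \<alpha> *\<^sub>R v + \<beta> *\<^sub>R e" using u(1) unfolding w_def w'_def by blast
  ultimately show ?thesis using nu(1) z by metis
qed

text \<open>If \<open>\<bar>\<mu>\<bar>\<close> is at most \<open>c0 / 64 * \<xi>\<close>, the
  circle of radius \<xi> itself works by \<open>far_estimate\<close>. Otherwise
  \<open>near_estimate\<close> applies below the smaller radius \<open>\<xi>'\<close>, still at
  least \<open>\<rho> * \<xi>\<close>; this costs the factor \<open>\<rho>^3\<close>. The constant
  therefore does not depend on \<mu>.\<close>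

lemma plane_estimate:
  assumes \<xi>: "0 < \<xi>" "\<xi> \<le> 1" "32 * (M * \<xi>) \<le> c0" and ball: "cball x \<xi> \<subseteq> S"
    and C: "C = c0 / (10^8 * M) * (c0 * c0 / (64 * 10^8 * M^3))^3"
  shows "\<exists>\<eta>. 0 \<le> \<eta> \<and> \<eta> \<le> \<xi> \<and> (\<forall>s t. s\<^sup>2 + t\<^sup>2 = \<eta>\<^sup>2 \<longrightarrow>
    (\<exists>\<alpha> \<beta>. norm (\<alpha> *\<^sub>R v + \<beta> *\<^sub>R e) = 1 \<and>
      C * \<xi>^3 \<le> \<bar>diff_form f (x + (s *\<^sub>R v + t *\<^sub>R e)) [\<alpha> *\<^sub>R v + \<beta> *\<^sub>R e]\<bar>))"
proof -
  \<comment> \<open>\<sigma> is the ratio of the radius to \<open>\<bar>\<mu>\<bar>\<close> that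
    \<open>near_estimate\<close> admits; multiplied by the threshold \<open>c0 / 64\<close> it gives
    \<rho>.\<close>
  define \<sigma> where "\<sigma> = c0 / (10^8 * M^3)"
  define \<rho> where "\<rho> = c0 * c0 / (64 * 10^8 * M^3)"
  define k where "k = c0 / (10^8 * M)"
  have M3: "1 \<le> M^3" "0 < M^3" using M(1) by (auto intro: one_le_power zero_less_power)
  have \<sigma>: "0 < \<sigma>" "\<sigma> \<le> 1"
    using c0 M3 unfolding \<sigma>_def by (intro divide_pos_pos mult_pos_pos, simp_all add: divide_le_eq_1)
  have "0 < \<sigma> * (c0 / 64)" using \<sigma>(1) c0(1) by simp
  moreover have "\<rho> = \<sigma> * (c0 / 64)" by (simp add: \<rho>_def \<sigma>_def)
  ultimately have \<rho>: "0 < \<rho>" "\<rho> = \<sigma> * (c0 / 64)" by simp_all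
  have \<rho>1: "\<rho> \<le> 1" unfolding \<rho>(2) using \<sigma> c0 by (intro mult_le_one) auto
  have k: "0 < k" "k \<le> c0 / 16" using c0 M(1) by (simp_all add: k_def field_simps)
  have Ck: "C = k * \<rho>^3" by (simp add: C k_def \<rho>_def)
  show ?thesis
  proof (cases "\<bar>\<mu>\<bar> \<le> c0 / 64 * \<xi>")
    case True
    have "C * \<xi>^3 \<le> c0 / 16 * \<xi>\<^sup>2"
    proof (rule mult_mono)
      have "k * \<rho>^3 \<le> k" using k \<rho>1 \<rho>(1) by (intro mult_right_le_one_le) (auto intro: power_le_one)
      then show "C \<le> c0 / 16" using k Ck by linarith
      show "\<xi>^3 \<le> \<xi>\<^sup>2" using \<xi> by (intro power_decreasing) auto
    qed (use c0 \<xi> in auto)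
    then have "\<exists>\<alpha> \<beta>. norm (\<alpha> *\<^sub>R v + \<beta> *\<^sub>R e) = 1 \<and>
      C * \<xi>^3 \<le> \<bar>diff_form f (x + (s *\<^sub>R v + t *\<^sub>R e)) [\<alpha> *\<^sub>R v + \<beta> *\<^sub>R e]\<bar>" if "s\<^sup>2 + t\<^sup>2 = \<xi>\<^sup>2" for s t
      using far_estimate[OF \<xi>(1,3) True \<xi>(2) ball that] order_trans by blast
    then show ?thesis using \<xi>(1) by (intro exI[of _ \<xi>]) auto
  next
    case False
    define \<xi>' where "\<xi>' = min \<xi> (\<sigma> * \<bar>\<mu>\<bar>)"
    have \<rho>\<xi>: "\<rho> * \<xi> \<le> \<xi>'"
    proof -
      have "\<rho> * \<xi> \<le> \<xi>" using \<rho>1 \<rho>(1) \<xi>(1) by (intro mult_left_le_one_le) auto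
      moreover have "\<rho> * \<xi> \<le> \<sigma> * \<bar>\<mu>\<bar>"
        using mult_left_mono[of "c0 / 64 * \<xi>" "\<bar>\<mu>\<bar>" \<sigma>] False \<sigma>(1) unfolding \<rho>(2) by simp
      ultimately show ?thesis by (simp add: \<xi>'_def)
    qed
    have \<xi>'0: "0 < \<xi>'" using \<rho>\<xi> \<rho>(1) \<xi>(1) by (meson less_le_trans mult_pos_pos)
    have \<xi>'1: "\<xi>' \<le> \<xi>" by (simp add: \<xi>'_def)
    have \<xi>'\<sigma>: "\<xi>' \<le> c0 / (10^8 * M^3) * \<bar>\<mu>\<bar>" by (simp add: \<xi>'_def \<sigma>_def)
    have ball': "cball x \<xi>' \<subseteq> S" using ball \<xi>'1 by auto
    obtain \<eta> where \<eta>: "0 \<le> \<eta>" "\<eta> \<le> \<xi>'" "\<And>s t. s\<^sup>2 + t\<^sup>2 = \<eta>\<^sup>2 \<Longrightarrow>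
       k * \<xi>'^3 \<le> \<bar>diff_form f (x + (s *\<^sub>R v + t *\<^sub>R e)) [v]\<bar> \<or>
       k * \<xi>'^3 \<le> \<bar>diff_form f (x + (s *\<^sub>R v + t *\<^sub>R e)) [e]\<bar>"
      using near_estimate[OF \<xi>'0 order_trans[OF \<xi>'1 \<xi>(2)] \<xi>'\<sigma> ball'] unfolding k_def by blast
    have "C * \<xi>^3 = k * (\<rho> * \<xi>)^3" by (simp add: Ck power_mult_distrib)
    also have "\<dots> \<le> k * \<xi>'^3" using k \<rho>\<xi> \<rho>(1) \<xi>(1) by (intro mult_left_mono power_mono) auto
    finally have C\<xi>: "C * \<xi>^3 \<le> k * \<xi>'^3" .
    have "\<exists>\<alpha> \<beta>. norm (\<alpha> *\<^sub>R v + \<beta> *\<^sub>R e) = 1 \<and>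
      C * \<xi>^3 \<le> \<bar>diff_form f (x + (s *\<^sub>R v + t *\<^sub>R e)) [\<alpha> *\<^sub>R v + \<beta> *\<^sub>R e]\<bar>" if "s\<^sup>2 + t\<^sup>2 = \<eta>\<^sup>2" for s t
      using \<eta>(3)[OF that]
    proof
      assume "k * \<xi>'^3 \<le> \<bar>diff_form f (x + (s *\<^sub>R v + t *\<^sub>R e)) [v]\<bar>"
      then show ?thesis using C\<xi> ve by (intro exI[of _ 1] exI[of _ 0]) auto
    next
      assume "k * \<xi>'^3 \<le> \<bar>diff_form f (x + (s *\<^sub>R v + t *\<^sub>R e)) [e]\<bar>"
      then show ?thesis using C\<xi> ve by (intro exI[of _ 0] exI[of _ 1]) auto
    qed
    then show ?thesis using \<eta> \<xi>'1 by (intro exI[of _ \<eta>]) auto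
  qed
qed

end

section \<open>Uniform steepness near a point\<close>

text \<open>Nonzero orthogonal vectors are independent. Orthonormal pairs solving the system of the
  second hypothesis thus contradict its rank condition.\<close>

lemma rk2_orthonormal:
  fixes u v :: "real^'n::finite"
  assumes "norm u = 1" "norm v = 1" "u \<bullet> v = 0"
  shows "rk2 u v = 2"
proof -
  have ne: "u \<noteq> v" using assms by (auto simp: norm_eq_1)
  have "rows (vector [u, v] :: (real^'n)^2) = {u, v}"
  proof -
    have "rows A = range (\<lambda>i. A $ i)" for A :: "(real^'n)^2"
      by (auto simp: rows_def row_def)
    then show ?thesis by (simp add: UNIV_2 vector_2)
  qed
  moreover have "independent {u, v}"
    by (rule pairwise_orthogonal_independent)
      (use assms in \<open>auto simp: pairwise_def orthogonal_def inner_commute\<close>)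
  ultimately show ?thesis
    using ne by (simp only: rk2_def rank_transpose) (simp add: row_rank_def dim_eq_card_independent)
qed

lemma compact_orthonormal_pairs:
  "compact {p :: 'a::euclidean_space \<times> 'a. norm (fst p) = 1 \<and> norm (snd p) = 1 \<and> fst p \<bullet> snd p = 0}"
proof -
  have "closed {p :: 'a \<times> 'a. fst p \<bullet> snd p = 0}"
    by (intro closed_Collect_eq continuous_intros)
  then have "compact ((sphere 0 1 \<times> sphere 0 1) \<inter> {p :: 'a \<times> 'a. fst p \<bullet> snd p = 0})"
    by (intro compact_Int_closed compact_Times compact_sphere)
  also have "(sphere 0 1 \<times> sphere 0 1) \<inter> {p :: 'a \<times> 'a. fst p \<bullet> snd p = 0}
      = {p. norm (fst p) = 1 \<and> norm (snd p) = 1 \<and> fst p \<bullet> snd p = 0}"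
    by auto
  finally show ?thesis .
qed

section \<open>Lines through points near \<open>I\<close>\<close>

lemma cball_subset_cball_half:
  fixes x :: "'a::metric_space"
  assumes "x \<in> ball I (d / 2)" "\<delta> \<le> d / 2"
  shows "cball x \<delta> \<subseteq> cball I d"
proof
  fix y assume "y \<in> cball x \<delta>"
  then show "y \<in> cball I d" using assms dist_triangle[of I y x] by simp
qed

text \<open>Nondegeneracy makes the sum of the first five forms positive on the unit sphere at
  \<open>I\<close>, and compactness keeps it above some \<open>c\<close> at all nearby points. With
  this uniform constant \<open>line_estimate\<close> gives the index 4.\<close>

lemma steep_on_lines:
  fixes f :: "real^'n::finite \<Rightarrow> real"
  assumes f: "smooth_on A f" "open A" and I: "I \<in> A" and jet: "five_jet_nondegenerate f I"
  obtains C \<delta> R where "C > 0" "\<delta> > 0" "R > 0" "\<And>x. x \<in> ball I R \<Longrightarrow> steep_ineq A f 1 C \<delta> 4 x"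
proof -
  obtain r where r: "r > 0" "cball I r \<subseteq> A" using f(2) I open_contains_cball by blast
  define F where "F = (\<lambda>p. \<Sum>k=1..5. \<bar>diff_form f (fst p) (replicate k (snd p :: real^'n))\<bar>)"
  have F: "continuous_on (cball I r \<times> sphere 0 1) F"
  proof -
    have "continuous_on (cball I r \<times> sphere 0 1) (\<lambda>p. diff_form f (fst p) (map (\<lambda>W. W p) (replicate k snd)))" for k
      by (rule diff_form_continuous_on[OF f(1)]) (use r in \<open>auto intro!: continuous_intros\<close>)
    then show ?thesis unfolding F_def by (auto intro!: continuous_intros simp: map_replicate)
  qed
  have pos: "F (I, v) > 0" if v: "v \<in> sphere 0 1" for v
  proof -
    obtain k where k: "k \<in> {1..5}" "diff_form f I (replicate k v) \<noteq> 0"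
      using jet v unfolding five_jet_nondegenerate_def by fastforce
    then have "0 < \<bar>diff_form f I (replicate k v)\<bar>" by simp
    also have "\<dots> \<le> (\<Sum>k=1..5. \<bar>diff_form f I (replicate k v)\<bar>)"
      by (rule member_le_sum[OF k(1)]) auto
    finally show ?thesis by (simp add: F_def)
  qed
  obtain c d where cd: "c > 0" "0 < d" "d \<le> r" "\<And>x v. x \<in> cball I d \<Longrightarrow> v \<in> sphere 0 1 \<Longrightarrow> c \<le> F (x, v)"
    using compact_positive_nearby[OF compact_sphere r(1) F pos] by metis
  have dA: "cball I d \<subseteq> A" using r(2) cd(3) by auto
  obtain M where M: "M \<ge> 1"
    "\<And>y vs. y \<in> cball I d \<Longrightarrow> length vs \<le> 6 \<Longrightarrow> \<bar>diff_form f y vs\<bar> \<le> M * prod_list (map norm vs)"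
    using diff_form_bound[OF f(1) compact_cball dA, of 6] by blast
  define \<delta> where "\<delta> = min (d / 2) (min 1 (c / (10^8 * M)))"
  define C where "C = c / (2 * 10^8)"
  have \<delta>: "0 < \<delta>" "\<delta> \<le> d / 2" "\<delta> \<le> 1" "\<delta> \<le> c / (10^8 * M)" using cd M(1) by (auto simp: \<delta>_def)
  have "steep_ineq A f 1 C \<delta> 4 x" if x: "x \<in> ball I (d / 2)" for x
  proof (rule steep_ineqI[OF f])
    have "cball x \<delta> \<subseteq> cball I d" by (rule cball_subset_cball_half[OF x \<delta>(2)])
    note sub = this
    then show "cball x \<delta> \<subseteq> A" using dA by blast
    show "(1::nat) \<le> 1" "0 < C" using cd by (simp_all add: C_def)
    fix L \<xi>
    assume L: "affine L" "aff_dim L = int 1" "x \<in> L" "\<And>y. y \<in> L \<Longrightarrow> (y - x) \<bullet> gradient f x = 0"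
      and \<xi>: "0 < \<xi>" "\<xi> \<le> \<delta>"
    obtain v where v: "norm v = 1" "\<And>y. y \<in> L \<longleftrightarrow> (\<exists>t. y = x + t *\<^sub>R v)"
      using affine_line[OF L(1,3)] L(2) by (metis of_nat_1)
    have xv: "x + v \<in> L" using v(2) by (metis scaleR_one)
    have v0: "diff_form f x [v] = 0"
      using L(4)[OF xv] by (simp add: inner_commute flip: gradient_inner_eq_diff_form)
    have xd: "x \<in> cball I d" using sub \<delta>(1) centre_in_cball[of x \<delta>] by (meson less_imp_le subsetD)
    have "c \<le> F (x, v)" using cd(4)[OF xd] v(1) by simp
    \<comment> \<open>The term of order 1 vanishes on a line orthogonal to the gradient, so the
      lower bound falls on the orders 2 to 5.\<close>
    also have "F (x, v) = (\<Sum>k=2..5. \<bar>diff_form f x (replicate k v)\<bar>)"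
      using v0 by (simp add: F_def eval_nat_numeral)
    finally have cF: "c \<le> (\<Sum>k=2..5. \<bar>diff_form f x (replicate k v)\<bar>)" .
    have "10^8 * (M * \<xi>) \<le> c" using order_trans[OF \<xi>(2) \<delta>(4)] M(1) by (simp add: field_simps)
    moreover have "cball x \<xi> \<subseteq> cball I d" using sub \<xi>(2) by auto
    ultimately obtain \<eta> where \<eta>: "0 \<le> \<eta>" "\<eta> \<le> \<xi>" 
        "\<And>t. \<bar>t\<bar> = \<eta> \<Longrightarrow> c / 10^8 * \<xi>^4 \<le> \<bar>diff_form f (x + t *\<^sub>R v) [v]\<bar>"
      using line_estimate[OF f convex_cball dA _ M v(1) v0 cd(1) cF \<xi>(1)] \<xi>(2) \<delta>(3) by (meson order_trans)
    have "2 * C * \<xi> powr 4 \<le> norm (gradient_on L f y)" if y: "y \<in> L" "norm (x - y) = \<eta>" for y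
    proof -
      obtain t where t: "y = x + t *\<^sub>R v" using v(2) y(1) by blast
      then have "\<bar>t\<bar> = \<eta>" using y(2) v(1) by simp
      then have "c / 10^8 * \<xi>^4 \<le> \<bar>diff_form f y [v]\<bar>" using \<eta>(3) t by simp
      moreover have "y \<in> cball x \<delta>" using y(2) \<eta>(2) \<xi>(2) by (simp add: dist_norm)
      then have "f differentiable (at y)"
        using smooth_on_differentiable[OF f, of y "[]"] sub dA by (metis iter_partial.simps(1) subsetD)
      then have "\<bar>diff_form f y [v]\<bar> \<le> norm (gradient_on L f y)"
        using diff_form_le_norm_gradient_on[OF L(1) y(1) _ L(3) xv v(1)] by blast
      ultimately show ?thesis using \<xi>(1) by (simp add: C_def powr_numeral)
    qed
    then show "\<exists>\<eta>. 0 \<le> \<eta> \<and> \<eta> \<le> \<xi> \<and>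
        (\<forall>y\<in>L. norm (x - y) = \<eta> \<longrightarrow> 2 * C * \<xi> powr 4 \<le> norm (gradient_on L f y))"
      using \<eta>(1,2) by blast
  qed
  then show thesis using that[of C \<delta> "d / 2"] cd \<delta>(1) by (simp add: C_def)
qed

section \<open>Planes through points near \<open>I\<close>\<close>

definition quartic_nondegenerate :: "(real^'n::finite \<Rightarrow> real) \<Rightarrow> real^'n \<Rightarrow> bool" where
  "quartic_nondegenerate f x \<longleftrightarrow> (\<forall>v u. v \<noteq> 0 \<and> diff_form f x [v] = 0 \<and> diff_form f x [v, v] = 0 \<and>
     diff_form f x [v, v, v] = 0 \<and> diff_form f x [u] = 0 \<and> diff_form f x [u, v] = 0 \<and>
     diff_form f x [u, u] * diff_form f x [v, v, v, v] = 3 * (diff_form f x [v, v, u])\<^sup>2 \<longrightarrow> rk2 u v < 2)"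

text \<open>The admissible pairs vary with \<open>x\<close>. So the constraints are not imposed on
  the compact set \<open>K\<close> but added to \<open>F\<close> and \<open>G\<close> as nonnegative
  penalty terms. At \<open>I\<close> both functions are positive on \<open>K\<close>, since a zero
  would be an orthonormal solution of the system with \<open>u = e\<close>. At admissible pairs the
  penalties vanish and the stated bounds remain.\<close>

lemma nondegenerate_orthonormal_pairs:
  fixes f :: "real^'n::finite \<Rightarrow> real"
  assumes f: "smooth_on A f" "open A" and I: "I \<in> A"
    and nondeg: "quartic_nondegenerate f I"
  obtains c d where "0 < c" "c \<le> 1" "0 < d" "cball I d \<subseteq> A"
    "\<And>x v e. \<lbrakk>x \<in> cball I d; norm v = 1; norm e = 1; v \<bullet> e = 0; diff_form f x [v] = 0; diff_form f x [e] = 0;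
        diff_form f x [v, e] = 0; \<bar>diff_form f x [v, v]\<bar> \<le> \<bar>diff_form f x [e, e]\<bar>\<rbrakk> \<Longrightarrow>
      c \<le> \<bar>diff_form f x [e, e] * diff_form f x [v, v]\<bar> + \<bar>diff_form f x [v, v, v]\<bar>
        + \<bar>diff_form f x [e, e] * diff_form f x [v, v, v, v] / 6 - (diff_form f x [v, v, e])\<^sup>2 / 2\<bar>"
    "\<And>x w w'. \<lbrakk>x \<in> cball I d; norm w = 1; norm w' = 1; w \<bullet> w' = 0; diff_form f x [w] = 0; diff_form f x [w'] = 0\<rbrakk> \<Longrightarrow>
      c \<le> \<bar>diff_form f x [w, w]\<bar> + \<bar>diff_form f x [w, w']\<bar> + \<bar>diff_form f x [w', w']\<bar>
        + \<bar>diff_form f x [w, w, w]\<bar> + \<bar>diff_form f x [w, w, w']\<bar>"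
proof -
  obtain r where r: "r > 0" "cball I r \<subseteq> A" using f(2) I open_contains_cball by blast
  define K where "K = {p :: (real^'n) \<times> (real^'n). norm (fst p) = 1 \<and> norm (snd p) = 1 \<and> fst p \<bullet> snd p = 0}"
  let ?v = "\<lambda>p :: (real^'n) \<times> (real^'n) \<times> (real^'n). fst (snd p)"
  let ?e = "\<lambda>p :: (real^'n) \<times> (real^'n) \<times> (real^'n). snd (snd p)"
  let ?h = "\<lambda>p. diff_form f (fst p)"
  have cont: "continuous_on (cball I r \<times> K) (\<lambda>p. diff_form f (fst p) (map (\<lambda>W. W p) Ws))" if "set Ws \<subseteq> {?v, ?e}" for Ws
    by (rule diff_form_continuous_on[OF f(1)]) (use r that in \<open>auto intro!: continuous_intros\<close>)
  define F where "F = (\<lambda>p. \<bar>?h p [?v p]\<bar> + \<bar>?h p [?e p]\<bar> + \<bar>?h p [?v p, ?e p]\<bar>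
    + max 0 (\<bar>?h p [?v p, ?v p]\<bar> - \<bar>?h p [?e p, ?e p]\<bar>)
    + (\<bar>?h p [?e p, ?e p] * ?h p [?v p, ?v p]\<bar> + \<bar>?h p [?v p, ?v p, ?v p]\<bar>
    + \<bar>?h p [?e p, ?e p] * ?h p [?v p, ?v p, ?v p, ?v p] / 6 - (?h p [?v p, ?v p, ?e p])\<^sup>2 / 2\<bar>))"
  define G where "G = (\<lambda>p. \<bar>?h p [?v p]\<bar> + \<bar>?h p [?e p]\<bar> + (\<bar>?h p [?v p, ?v p]\<bar> + \<bar>?h p [?v p, ?e p]\<bar>
    + \<bar>?h p [?e p, ?e p]\<bar> + \<bar>?h p [?v p, ?v p, ?v p]\<bar> + \<bar>?h p [?v p, ?v p, ?e p]\<bar>))"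
  note c = cont[of "[?v]", simplified] cont[of "[?e]", simplified] cont[of "[?v, ?e]", simplified]
    cont[of "[?v, ?v]", simplified] cont[of "[?e, ?e]", simplified] cont[of "[?v, ?v, ?v]", simplified]
    cont[of "[?v, ?v, ?e]", simplified] cont[of "[?v, ?v, ?v, ?v]", simplified]
  have F: "continuous_on (cball I r \<times> K) F" and G: "continuous_on (cball I r \<times> K) G"
    unfolding F_def G_def by (intro continuous_intros c; simp)+
  have KI: "diff_form f I [v] \<noteq> 0 \<or> diff_form f I [v, v] \<noteq> 0 \<or> diff_form f I [v, v, v] \<noteq> 0 \<or>
      diff_form f I [e] \<noteq> 0 \<or> diff_form f I [v, e] \<noteq> 0 \<or>
      diff_form f I [e, e] * diff_form f I [v, v, v, v] \<noteq> 3 * (diff_form f I [v, v, e])\<^sup>2"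
    if "(v, e) \<in> K" for v e
  proof (rule ccontr)
    assume *: "\<not> ?thesis"
    have ve: "norm v = 1" "norm e = 1" "e \<bullet> v = 0" using that by (auto simp: K_def inner_commute)
    then have "v \<noteq> 0" by auto
    moreover have "diff_form f I [e, v] = 0" using diff_form_swap[OF f I, of "[]" e v "[]"] * by simp
    ultimately have "rk2 e v < 2" using nondeg * unfolding quartic_nondegenerate_def by blast
    then show False using rk2_orthonormal[OF ve(2,1,3)] by simp
  qed
  have Fpos: "F (I, k) > 0" if "k \<in> K" for k
  proof (rule ccontr)
    obtain v e where k: "k = (v, e)" by (cases k)
    have zero: "p = 0 \<and> q = 0 \<and> r = 0 \<and> m = 0 \<and> s = 0 \<and> t = 0 \<and> u = 0"
      if "\<not> 0 < \<bar>p\<bar> + \<bar>q\<bar> + \<bar>r\<bar> + m + (\<bar>s\<bar> + \<bar>t\<bar> + \<bar>u\<bar>)" "0 \<le> m" for p q r m s t u :: real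
    proof -
      have "\<bar>p\<bar> + \<bar>q\<bar> + \<bar>r\<bar> + m + (\<bar>s\<bar> + \<bar>t\<bar> + \<bar>u\<bar>) = 0" using that by (intro antisym) auto
      then show ?thesis using that(2) by (simp add: add_nonneg_eq_0_iff)
    qed
    define m where "m = max 0 (\<bar>diff_form f I [v, v]\<bar> - \<bar>diff_form f I [e, e]\<bar>)"
    have "0 \<le> m" by (simp add: m_def)
    assume "\<not> F (I, k) > 0"
    then have z: "diff_form f I [v] = 0" "diff_form f I [e] = 0" "diff_form f I [v, e] = 0"
      "m = 0" "diff_form f I [e, e] * diff_form f I [v, v] = 0" "diff_form f I [v, v, v] = 0"
      "diff_form f I [e, e] * diff_form f I [v, v, v, v] / 6 - (diff_form f I [v, v, e])\<^sup>2 / 2 = 0"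
      using zero[OF _ \<open>0 \<le> m\<close>] by (simp_all only: F_def k fst_conv snd_conv m_def[symmetric])
    have "\<bar>diff_form f I [v, v]\<bar> \<le> \<bar>diff_form f I [e, e]\<bar>" using z(4) by (simp add: m_def)
    \<comment> \<open>One factor of the product vanishes, and by the ordering of the moduli the
      smaller one does in either case.\<close>
    then have "diff_form f I [v, v] = 0" using z(5) by auto
    moreover have "diff_form f I [e, e] * diff_form f I [v, v, v, v] = 3 * (diff_form f I [v, v, e])\<^sup>2"
      using z(7) by simp
    ultimately show False using KI[of v e] that z by (simp add: k)
  qed
  have Gpos: "G (I, k) > 0" if "k \<in> K" for k
  proof (rule ccontr)
    obtain v e where k: "k = (v, e)" by (cases k)
    assume "\<not> G (I, k) > 0"
    then have z: "diff_form f I [v] = 0" "diff_form f I [e] = 0" "diff_form f I [v, v] = 0" "diff_form f I [v, e] = 0"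
      "diff_form f I [e, e] = 0" "diff_form f I [v, v, v] = 0" "diff_form f I [v, v, e] = 0"
      by (simp_all add: G_def k)
    \<comment> \<open>Both sides of the quartic equation are zero here, which is why
      \<open>G\<close> contains no fourth derivative.\<close>
    then show False using KI[of v e] that by (simp add: k)
  qed
  have K: "compact K" unfolding K_def by (rule compact_orthonormal_pairs)
  obtain c1 d1 where 1: "c1 > 0" "0 < d1" "d1 \<le> r" "\<And>x k. x \<in> cball I d1 \<Longrightarrow> k \<in> K \<Longrightarrow> c1 \<le> F (x, k)"
    using compact_positive_nearby[OF K r(1) F Fpos] by metis
  obtain c2 d2 where 2: "c2 > 0" "0 < d2" "d2 \<le> r" "\<And>x k. x \<in> cball I d2 \<Longrightarrow> k \<in> K \<Longrightarrow> c2 \<le> G (x, k)"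
    using compact_positive_nearby[OF K r(1) G Gpos] by metis
  show thesis
  proof (rule that[of "min 1 (min c1 c2)" "min d1 d2"])
    show "0 < min 1 (min c1 c2)" "min 1 (min c1 c2) \<le> 1" "0 < min d1 d2" using 1 2 by simp_all
    show "cball I (min d1 d2) \<subseteq> A" using r(2) 1(3) by auto
  next
    fix x v e
    assume x: "x \<in> cball I (min d1 d2)" and ve: "norm v = 1" "norm e = 1" "v \<bullet> e = 0"
      and z: "diff_form f x [v] = 0" "diff_form f x [e] = 0" "diff_form f x [v, e] = 0"
        "\<bar>diff_form f x [v, v]\<bar> \<le> \<bar>diff_form f x [e, e]\<bar>"
    have "c1 \<le> F (x, (v, e))" using 1(4) x ve by (simp add: K_def)
    also have "F (x, (v, e)) = \<bar>diff_form f x [e, e] * diff_form f x [v, v]\<bar> + \<bar>diff_form f x [v, v, v]\<bar>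
        + \<bar>diff_form f x [e, e] * diff_form f x [v, v, v, v] / 6 - (diff_form f x [v, v, e])\<^sup>2 / 2\<bar>"
      using z by (simp add: F_def)
    finally show "min 1 (min c1 c2) \<le> \<dots>" by (simp add: min_le_iff_disj)
  next
    fix x w w'
    assume x: "x \<in> cball I (min d1 d2)" and ve: "norm w = 1" "norm w' = 1" "w \<bullet> w' = 0"
      and z: "diff_form f x [w] = 0" "diff_form f x [w'] = 0"
    have "c2 \<le> G (x, (w, w'))" using 2(4) x ve by (simp add: K_def)
    also have "G (x, (w, w')) = \<bar>diff_form f x [w, w]\<bar> + \<bar>diff_form f x [w, w']\<bar> + \<bar>diff_form f x [w', w']\<bar>
        + \<bar>diff_form f x [w, w, w]\<bar> + \<bar>diff_form f x [w, w, w']\<bar>"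
      using z by (simp add: G_def)
    finally show "min 1 (min c1 c2) \<le> \<dots>" by (simp add: min_le_iff_disj)
  qed
qed

text \<open>In each plane through a nearby point the Hessian is diagonalized separately. The
  constants \<open>c\<close> and \<open>M\<close> are common to all points and planes, so
  \<open>plane_estimate\<close> yields uniform coefficients, and its exponent 3 is the
  index.\<close>

lemma steep_on_planes:
  fixes f :: "real^'n::finite \<Rightarrow> real"
  assumes f: "smooth_on A f" "open A" and I: "I \<in> A"
    and nondeg: "quartic_nondegenerate f I"
  obtains C \<delta> R where "C > 0" "\<delta> > 0" "R > 0" "\<And>x. x \<in> ball I R \<Longrightarrow> steep_ineq A f 2 C \<delta> 3 x"
proof -
  obtain c d where c: "0 < c" "c \<le> 1" and d: "0 < d" "cball I d \<subseteq> A"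
    and quartic: "\<And>x v e. \<lbrakk>x \<in> cball I d; norm v = 1; norm e = 1; v \<bullet> e = 0; diff_form f x [v] = 0; diff_form f x [e] = 0;
        diff_form f x [v, e] = 0; \<bar>diff_form f x [v, v]\<bar> \<le> \<bar>diff_form f x [e, e]\<bar>\<rbrakk> \<Longrightarrow>
      c \<le> \<bar>diff_form f x [e, e] * diff_form f x [v, v]\<bar> + \<bar>diff_form f x [v, v, v]\<bar>
        + \<bar>diff_form f x [e, e] * diff_form f x [v, v, v, v] / 6 - (diff_form f x [v, v, e])\<^sup>2 / 2\<bar>"
    and cubic: "\<And>x w w'. \<lbrakk>x \<in> cball I d; norm w = 1; norm w' = 1; w \<bullet> w' = 0; diff_form f x [w] = 0; diff_form f x [w'] = 0\<rbrakk> \<Longrightarrow>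
      c \<le> \<bar>diff_form f x [w, w]\<bar> + \<bar>diff_form f x [w, w']\<bar> + \<bar>diff_form f x [w', w']\<bar>
        + \<bar>diff_form f x [w, w, w]\<bar> + \<bar>diff_form f x [w, w, w']\<bar>"
    using nondegenerate_orthonormal_pairs[OF f I nondeg] by blast
  obtain M where M: "M \<ge> 1"
    "\<And>y vs. y \<in> cball I d \<Longrightarrow> length vs \<le> 6 \<Longrightarrow> \<bar>diff_form f y vs\<bar> \<le> M * prod_list (map norm vs)"
    using diff_form_bound[OF f(1) compact_cball d(2), of 6] by blast
  define \<delta> where "\<delta> = min (d / 2) (min 1 (c / (32 * M)))"
  define C where "C = c / (10^8 * M) * (c * c / (64 * 10^8 * M^3))^3"
  have \<delta>: "0 < \<delta>" "\<delta> \<le> d / 2" "\<delta> \<le> 1" "\<delta> \<le> c / (32 * M)" using c d M(1) by (auto simp: \<delta>_def min_le_iff_disj)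
  have C: "0 < C" using c M(1) unfolding C_def by (intro mult_pos_pos divide_pos_pos zero_less_power) auto
  have "steep_ineq A f 2 (C / 2) \<delta> 3 x" if x: "x \<in> ball I (d / 2)" for x
  proof (rule steep_ineqI[OF f])
    have sub: "cball x \<delta> \<subseteq> cball I d" by (rule cball_subset_cball_half[OF x \<delta>(2)])
    then show "cball x \<delta> \<subseteq> A" using d(2) by blast
    show "(1::nat) \<le> 2" "0 < C / 2" using C by simp_all
    fix L \<xi>
    assume L: "affine L" "aff_dim L = int 2" "x \<in> L" "\<And>y. y \<in> L \<Longrightarrow> (y - x) \<bullet> gradient f x = 0"
      and \<xi>: "0 < \<xi>" "\<xi> \<le> \<delta>"
    have xd: "x \<in> cball I d" using sub \<delta>(1) centre_in_cball[of x \<delta>] by (meson less_imp_le subsetD)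
    have xA: "x \<in> A" using xd d(2) by blast
    obtain p q where pq: "norm p = 1" "norm q = 1" "p \<bullet> q = 0" "\<And>y. y \<in> L \<longleftrightarrow> (\<exists>s t. y = x + s *\<^sub>R p + t *\<^sub>R q)"
      using affine_plane[OF L(1,3)] L(2) by (metis of_nat_numeral)
    have lin: "diff_form f x [a *\<^sub>R u + b *\<^sub>R w, z] = a * diff_form f x [u, z] + b * diff_form f x [w, z]" for a b u w z
      by (rule diff_form_expand2)
    have sym: "diff_form f x [u, w] = diff_form f x [w, u]" for u w
      using diff_form_swap[OF f xA, of "[]" u w "[]"] by simp
    obtain v e where ve: "norm v = 1" "norm e = 1" "v \<bullet> e = 0" "diff_form f x [v, e] = 0"
        "\<bar>diff_form f x [v, v]\<bar> \<le> \<bar>diff_form f x [e, e]\<bar>"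
        "\<forall>y. (\<exists>s t. y = s *\<^sub>R p + t *\<^sub>R q) \<longleftrightarrow> (\<exists>s t. y = s *\<^sub>R v + t *\<^sub>R e)"
      by (rule diagonalize_symmetric_form[OF pq(1-3), of "\<lambda>a b. diff_form f x [a, b]", OF lin sym]) blast
    have Lz: "x + z \<in> L \<longleftrightarrow> (\<exists>s t. z = s *\<^sub>R v + t *\<^sub>R e)" for z
      unfolding pq(4) ve(6)[rule_format, symmetric] by (simp add: add.assoc)
    have crit: "diff_form f x [z] = 0" if "x + z \<in> L" for z
      using L(4)[OF that] by (simp add: inner_commute flip: gradient_inner_eq_diff_form)
    \<comment> \<open>Trivial coefficients show that \<open>v\<close> and \<open>e\<close> are
      directions of \<open>L\<close>, along which the first derivative vanishes.\<close>
    have "v = 1 *\<^sub>R v + 0 *\<^sub>R e" "e = 0 *\<^sub>R v + 1 *\<^sub>R e" by simp_all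
    then have "x + v \<in> L" "x + e \<in> L" using Lz by blast+
    then have crit_ve: "diff_form f x [v] = 0" "diff_form f x [e] = 0" using crit by blast+
    interpret plane_data f A "cball I d" x v e M c
      using f d M ve crit_ve xd c quartic[OF xd ve(1-3) crit_ve ve(4,5)] cubic[OF xd]
      by unfold_locales auto
    have "32 * (M * \<xi>) \<le> c" using order_trans[OF \<xi>(2) \<delta>(4)] M(1) by (simp add: field_simps)
    moreover have "cball x \<xi> \<subseteq> cball I d" using sub \<xi>(2) by auto
    moreover have "\<xi> \<le> 1" using \<xi>(2) \<delta>(3) by simp
    ultimately obtain \<eta> where \<eta>: "0 \<le> \<eta>" "\<eta> \<le> \<xi>" "\<And>s t. s\<^sup>2 + t\<^sup>2 = \<eta>\<^sup>2 \<Longrightarrow>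
        \<exists>\<alpha> \<beta>. norm (\<alpha> *\<^sub>R v + \<beta> *\<^sub>R e) = 1 \<and>
          C * \<xi>^3 \<le> \<bar>diff_form f (x + (s *\<^sub>R v + t *\<^sub>R e)) [\<alpha> *\<^sub>R v + \<beta> *\<^sub>R e]\<bar>"
      using plane_estimate[OF \<xi>(1) _ _ _ C_def] by blast
    have "2 * (C / 2) * \<xi> powr 3 \<le> norm (gradient_on L f y)" if y: "y \<in> L" "norm (x - y) = \<eta>" for y
    proof -
      have "x + (y - x) \<in> L" using y(1) by simp
      then obtain s t where st: "y - x = s *\<^sub>R v + t *\<^sub>R e" using Lz by blast
      have "s\<^sup>2 + t\<^sup>2 = (norm (y - x))\<^sup>2" unfolding st using norm_orthonormal_combination(1)[OF ve(1-3)] by simp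
      also have "\<dots> = \<eta>\<^sup>2" using y(2) by (simp add: norm_minus_commute)
      finally obtain \<alpha> \<beta> where w: "norm (\<alpha> *\<^sub>R v + \<beta> *\<^sub>R e) = 1"
          "C * \<xi>^3 \<le> \<bar>diff_form f y [\<alpha> *\<^sub>R v + \<beta> *\<^sub>R e]\<bar>"
        using \<eta>(3)[of s t] unfolding st[symmetric] by auto
      have "y \<in> cball x \<delta>" using y(2) \<eta>(2) \<xi>(2) by (simp add: dist_norm)
      then have "f differentiable (at y)"
        using smooth_on_differentiable[OF f, of y "[]"] sub d(2) by (metis iter_partial.simps(1) subsetD)
      moreover have "x + (\<alpha> *\<^sub>R v + \<beta> *\<^sub>R e) \<in> L" using Lz by blast
      ultimately have "\<bar>diff_form f y [\<alpha> *\<^sub>R v + \<beta> *\<^sub>R e]\<bar> \<le> norm (gradient_on L f y)"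
        using diff_form_le_norm_gradient_on[OF L(1) y(1) _ L(3) _ w(1)] by blast
      then show ?thesis using w(2) \<xi>(1) by (simp add: powr_numeral)
    qed
    then show "\<exists>\<eta>. 0 \<le> \<eta> \<and> \<eta> \<le> \<xi> \<and>
        (\<forall>y\<in>L. norm (x - y) = \<eta> \<longrightarrow> 2 * (C / 2) * \<xi> powr 3 \<le> norm (gradient_on L f y))"
      using \<eta>(1,2) by blast
  qed
  then show thesis using that[of "C / 2" \<delta> "d / 2"] C \<delta>(1) d(1) by simp
qed

text \<open>Pairing with the fixed vector \<open>w\<close>, the gradient at \<open>I\<close>, gives
  a continuous real function that is nonzero at \<open>I\<close>, hence also nearby.\<close>

lemma gradient_nonzero_nearby:
  fixes f :: "real^'n::finite \<Rightarrow> real"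
  assumes f: "smooth_on A f" "open A" and I: "I \<in> A" "gradient f I \<noteq> 0"
  obtains R where "R > 0" "ball I R \<subseteq> A" "\<And>x. x \<in> ball I R \<Longrightarrow> gradient f x \<noteq> 0"
proof -
  define w where "w = gradient f I"
  have "continuous_on A (\<lambda>x. diff_form f x (map (\<lambda>W. W x) [\<lambda>_. w]))"
    by (rule diff_form_continuous_on[OF f(1)]) auto
  then have "open (A \<inter> (\<lambda>x. diff_form f x [w]) -` (- {0}))"
    using f(2) by (intro continuous_open_preimage) auto
  moreover have "I \<in> A \<inter> (\<lambda>x. diff_form f x [w]) -` (- {0})"
    using I by (simp add: w_def flip: gradient_inner_eq_diff_form)
  ultimately obtain R where R: "R > 0" "ball I R \<subseteq> A \<inter> (\<lambda>x. diff_form f x [w]) -` (- {0})"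
    using openE by blast
  have "gradient f x \<noteq> 0" if "x \<in> ball I R" for x
    using R(2) that by (auto simp flip: gradient_inner_eq_diff_form)
  then show thesis using that R by blast
qed

theorem theorem4:
  fixes A :: "(real^3) set" and h :: "real^3 \<Rightarrow> real" and I :: "real^3"
  assumes "open A"
    and "smooth_on A h"
    and "I \<in> A"
    and "gradient h I \<noteq> 0"
    and "five_jet_nondegenerate h I"
    and "\<And>v u :: real^3.
           \<lbrakk> v \<noteq> 0;
             diff_form h I [v] = 0; diff_form h I [v, v] = 0; diff_form h I [v, v, v] = 0;
             diff_form h I [u] = 0; diff_form h I [u, v] = 0;
             diff_form h I [u, u] * diff_form h I [v, v, v, v] = 3 * (diff_form h I [v, v, u])\<^sup>2 \<rbrakk>
           \<Longrightarrow> rk2 u v < 2"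
  shows "\<exists>U. open U \<and> I \<in> U \<and> U \<subseteq> A \<and> steep_on A h U"
proof -
  obtain R0 where R0: "R0 > 0" "ball I R0 \<subseteq> A" "\<And>x. x \<in> ball I R0 \<Longrightarrow> gradient h x \<noteq> 0"
    using gradient_nonzero_nearby[OF assms(2,1,3,4)] by blast
  obtain C1 \<delta>1 R1 where 1: "C1 > 0" "\<delta>1 > 0" "R1 > 0" "\<And>x. x \<in> ball I R1 \<Longrightarrow> steep_ineq A h 1 C1 \<delta>1 4 x"
    using steep_on_lines[OF assms(2,1,3,5)] by blast
  obtain C2 \<delta>2 R2 where 2: "C2 > 0" "\<delta>2 > 0" "R2 > 0" "\<And>x. x \<in> ball I R2 \<Longrightarrow> steep_ineq A h 2 C2 \<delta>2 3 x"
    using steep_on_planes[OF assms(2,1,3), unfolded quartic_nondegenerate_def] assms(6) by blast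
  define U where "U = ball I (min R0 (min R1 R2))"
  have "\<exists>C \<delta> \<alpha>. C > 0 \<and> \<delta> > 0 \<and> \<alpha> > 1 \<and> (\<forall>x\<in>U. steep_ineq A h m C \<delta> \<alpha> x)" if "m \<in> {1..<CARD(3)}" for m
  proof -
    \<comment> \<open>In dimension 3 only lines, with index 4, and planes, with index 3, have to be
      considered.\<close>
    have "m = 1 \<or> m = 2" using that by auto
    then show ?thesis
    proof
      assume "m = 1"
      then show ?thesis using 1 by (intro exI[of _ C1] exI[of _ \<delta>1] exI[of _ 4]) (simp add: U_def)
    next
      assume "m = 2"
      then show ?thesis using 2 by (intro exI[of _ C2] exI[of _ \<delta>2] exI[of _ 3]) (simp add: U_def)
    qed
  qed
  then have "steep_on A h U" unfolding steep_on_def using R0(3) by (simp add: U_def)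
  moreover have "U \<subseteq> A" using R0(2) by (auto simp: U_def)
  moreover have "open U" "I \<in> U" using R0(1) 1(3) 2(3) by (simp_all add: U_def)
  ultimately show ?thesis by blast
qed

end
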